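(* Let $H$ be a finite simple graph with $i(H)\leq 2$, where $i(H)$ is the independence number of $H$. Let $G$ be the graph obtained from $H$ by adding a new vertex $y$ and connecting $y$ to every vertex of $H$. Then for every integer $k\geq 1$, $$k\deg(J(G))=\mathrm{reg}(J(G)^{(k)})=(k-1)\deg(J(G))+|V(G)|-1.$$ In particular, for the complete graph $K_n$ on $n$ vertices, $$\mathrm{reg}(J(K_n)^{(k)})=k(n-1)$$ for all integers $n\geq 2$ and $k\geq 1$.
   Context: The independence number $i(H)$ is the cardinality of a largest set of pairwise non-adjacent vertices of $H$. A vertex cover of a graph $G$ is a subset $C\subseteq V(G)$ meeting every edge of $G$; it is minimal if no proper subset of it is a vertex cover. Let $G$ be a finite simple graph with vertex set $\{x_1,\ldots,x_n\}$, let $\mathbb{K}$ be a field and $S=\mathbb{K}[x_1,\ldots,x_n]$ (vertices are identified with variables). The cover ideal of $G$ is $$J(G)=\Big(\prod_{x_i\in C}x_i \;\Big|\; C\text{ a minimal vertex cover of }G\Big)=\bigcap_{\{x_i,x_j\}\in E(G)}(x_i,x_j)\subseteq S,$$ and its $k$-th symbolic power is $J(G)^{(k)}=\bigcap_{\{x_i,x_j\}\in E(G)}(x_i,x_j)^k$ (an empty intersection is $S$). For a nonzero monomial ideal $I$, $\deg(I)$ is the maximum degree of a minimal monomial generator of $I$; thus $\deg(J(G))$ is the largest cardinality of a minimal vertex cover of $G$. For a nonzero homogeneous ideal $I\subseteq S$ with graded Betti numbers $\beta_{i,j}(I)$ (from the minimal graded free resolution $\cdots\to\bigoplus_jS(-j)^{\beta_{1,j}(I)}\to\bigoplus_jS(-j)^{\beta_{0,j}(I)}\to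 I\to 0$ of $I$), the Castelnuovo–Mumford regularity is $\mathrm{reg}(I)=\max\{j-i\mid \beta_{i,j}(I)\neq 0\}$. *)

theory Defs
  imports
    "HOL-Library.Poly_Mapping"
    "HOL-Library.Ramsey"
    "HOL-Algebra.Ideal_Product"
    "Jordan_Normal_Form.Matrix"
begin

section \<open>Graphs\<close>

text \<open>A graph is a pair of a vertex set and a set of two-element sets of vertices.\<close>

type_synonym 'v ugraph = "'v set \<times> 'v set set"

abbreviation verts :: "'v ugraph \<Rightarrow> 'v set" where "verts G \<equiv> fst G"
abbreviation edges :: "'v ugraph \<Rightarrow> 'v set set" where "edges G \<equiv> snd G"

definition finite_simple_graph :: "'v ugraph \<Rightarrow> bool" where
  "finite_simple_graph G \<longleftrightarrow> finite (verts G) \<and> edges G \<subseteq> nsets (verts G) 2"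

definition independence_number :: "'v ugraph \<Rightarrow> nat" where
  "independence_number G = Max {card A | A. A \<subseteq> verts G \<and> indep A (edges G)}"

definition complete_graph :: "'v set \<Rightarrow> 'v ugraph" where
  "complete_graph V = (V, nsets V 2)"

definition cone_graph :: "'v \<Rightarrow> 'v ugraph \<Rightarrow> 'v ugraph" where
  "cone_graph y H = (insert y (verts H), edges H \<union> {{y, v} | v. v \<in> verts H})"

definition vertex_cover :: "'v ugraph \<Rightarrow> 'v set \<Rightarrow> bool" where
  "vertex_cover G C \<longleftrightarrow> C \<subseteq> verts G \<and> (\<forall>e\<in>edges G. C \<inter> e \<noteq> {})"

definition minimal_vertex_cover :: "'v ugraph \<Rightarrow> 'v set \<Rightarrow> bool" where
  "minimal_vertex_cover G C \<longleftrightarrow> vertex_cover G C \<and> (\<forall>C'. C' \<subset> C \<longrightarrow> \<not> vertex_cover G C')"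


section \<open>Polynomial rings and ideals\<close>

text \<open>
  Monomials are finitely supported exponent functions, and polynomials are finitely supported
  families of coefficients indexed by monomials, multiplied by convolution. The polynomial ring
  in the variables \<open>V\<close> consists of the polynomials that involve no variable outside \<open>V\<close>.
\<close>

type_synonym 'v mon = "'v \<Rightarrow>\<^sub>0 nat"
type_synonym ('v, 'k) mpoly = "'v mon \<Rightarrow>\<^sub>0 'k"

definition poly_carrier :: "'v set \<Rightarrow> ('v, 'k::field) mpoly set" where
  "poly_carrier V = {p. \<forall>m\<in>Poly_Mapping.keys p. Poly_Mapping.keys m \<subseteq> V}"

definition poly_ring :: "'v set \<Rightarrow> ('v, 'k::field) mpoly ring" where
  "poly_ring V = \<lparr>carrier = poly_carrier V, monoid.mult = (*), one = 1, zero = 0, add = (+)\<rparr>"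

definition monomial :: "'v mon \<Rightarrow> ('v, 'k::field) mpoly" where
  "monomial m = Poly_Mapping.single m 1"

definition var :: "'v \<Rightarrow> ('v, 'k::field) mpoly" where
  "var v = monomial (Poly_Mapping.single v 1)"

definition mon_degree :: "'v mon \<Rightarrow> nat" where
  "mon_degree m = (\<Sum>v\<in>Poly_Mapping.keys m. Poly_Mapping.lookup m v)"

definition cover_ideal :: "'v ugraph \<Rightarrow> ('v, 'k::field) mpoly set" where
  "cover_ideal G = Idl\<^bsub>poly_ring (verts G)\<^esub> {\<Prod>x\<in>C. var x | C. minimal_vertex_cover G C}"

text \<open>
  Powers of ideals are taken in the monoid of ideals under the product of ideals. The
  intersection with the whole ring only matters for a graph without edges.
\<close>

definition symbolic_power :: "'v ugraph \<Rightarrow> nat \<Rightarrow> ('v, 'k::field) mpoly set" where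
  "symbolic_power G k = poly_carrier (verts G) \<inter>
     (\<Inter>e\<in>edges G. (Idl\<^bsub>poly_ring (verts G)\<^esub> (var ` e)) [^]\<^bsub>ideals_set (poly_ring (verts G))\<^esub> k)"

definition minimal_monomial_generators :: "'v set \<Rightarrow> ('v, 'k::field) mpoly set \<Rightarrow> 'v mon set \<Rightarrow> bool" where
  "minimal_monomial_generators V I B \<longleftrightarrow>
     (\<forall>m\<in>B. Poly_Mapping.keys m \<subseteq> V) \<and>
     Idl\<^bsub>poly_ring V\<^esub> (monomial ` B) = I \<and>
     (\<forall>B'. B' \<subset> B \<longrightarrow> Idl\<^bsub>poly_ring V\<^esub> (monomial ` B') \<noteq> I)"

text \<open>A monomial ideal has exactly one minimal set \<open>B\<close> of monomial generators.\<close>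

definition ideal_degree :: "'v set \<Rightarrow> ('v, 'k::field) mpoly set \<Rightarrow> nat" where
  "ideal_degree V I = Max {mon_degree m | m B. minimal_monomial_generators V I B \<and> m \<in> B}"


section \<open>Minimal graded free resolutions and regularity\<close>

text \<open>
  A sequence \<open>s\<close> of lists and a sequence \<open>D\<close> of matrices describe a complex of graded free modules.
  Writing \<open>S\<close> for the polynomial ring, \<open>F\<^sub>i\<close> is the direct sum of the modules \<open>S(-d)\<close>, where \<open>d\<close>
  runs through the list \<open>s i\<close> with repetitions. The matrix \<open>D 0\<close> is the augmentation from \<open>F\<^sub>0\<close>
  to \<open>S\<close>, and \<open>D (Suc i)\<close> is the differential from \<open>F\<^sub>i\<^sub>+\<^sub>1\<close> to \<open>F\<^sub>i\<close>; columns correspond to the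
  basis of the source. For an ideal of \<open>S\<close> all shifts in a minimal resolution are nonnegative,
  so they are natural numbers here.
\<close>

definition homogeneous_map :: "nat list \<Rightarrow> nat list \<Rightarrow> ('v, 'k::field) mpoly mat \<Rightarrow> bool" where
  "homogeneous_map t s A \<longleftrightarrow> A \<in> carrier_mat (length t) (length s) \<and>
     (\<forall>p<length t. \<forall>q<length s. \<forall>m\<in>Poly_Mapping.keys (A $$ (p, q)). mon_degree m + t ! p = s ! q)"

definition target_shifts :: "(nat \<Rightarrow> nat list) \<Rightarrow> nat \<Rightarrow> nat list" where
  "target_shifts s i = (case i of 0 \<Rightarrow> [0] | Suc i' \<Rightarrow> s i')"

definition free_module :: "'v set \<Rightarrow> nat \<Rightarrow> ('v, 'k::field) mpoly vec set" where
  "free_module V n = {v \<in> carrier_vec n. set\<^sub>v v \<subseteq> poly_carrier V}"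

definition minimal_graded_free_resolution ::
  "'v set \<Rightarrow> ('v, 'k::field) mpoly set \<Rightarrow> (nat \<Rightarrow> nat list) \<Rightarrow> (nat \<Rightarrow> ('v, 'k) mpoly mat) \<Rightarrow> bool"
where
  "minimal_graded_free_resolution V I s D \<longleftrightarrow>
     (\<forall>i. elements_mat (D i) \<subseteq> poly_carrier V \<and> homogeneous_map (target_shifts s i) (s i) (D i)) \<and>
     (\<lambda>v. (D 0 *\<^sub>v v) $ 0) ` free_module V (length (s 0)) = I \<and>
     (\<forall>i. (\<lambda>v. D (Suc i) *\<^sub>v v) ` free_module V (length (s (Suc i))) =
          {v \<in> free_module V (length (s i)). D i *\<^sub>v v = 0\<^sub>v (length (target_shifts s i))}) \<and>
     (\<forall>i. \<forall>a\<in>elements_mat (D (Suc i)). Poly_Mapping.lookup a 0 = 0)"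

text \<open>
  The last condition above is minimality: the differentials have entries in the ideal generated by
  the variables. Minimal graded free resolutions are unique up to isomorphism, so the choice below
  does not matter.
\<close>

definition graded_betti :: "'v set \<Rightarrow> ('v, 'k::field) mpoly set \<Rightarrow> nat \<Rightarrow> nat \<Rightarrow> nat" where
  "graded_betti V I i j =
     count_list (fst (SOME (s, D). minimal_graded_free_resolution V I s D) i) j"

definition regularity :: "'v set \<Rightarrow> ('v, 'k::field) mpoly set \<Rightarrow> int" where
  "regularity V I = Max {int j - int i | i j. graded_betti V I i j \<noteq> 0}"

end

theory Submission
  imports Defs "HOL-Library.Function_Algebras"
begin

text \<open>
  Write \<open>n\<close> for the number of vertices of the cone \<open>G\<close>. The largest minimal vertex cover of \<open>G\<close> is the
  vertex set of \<open>H\<close>, so \<open>deg (J G) = n - 1\<close>, and the \<open>k\<close>-th power of its monomial is a minimal generator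
  of the symbolic power; hence the regularity is at least \<open>k * (n - 1)\<close>.

  For the upper bound, regularity is read off from Koszul homology. In each multidegree \<open>a\<close> the
  Koszul complex of a monomial ideal is the chain complex of a simplicial complex. For the symbolic
  power this complex is a cone as soon as the degree is large: a vertex \<open>v\<close> that is not an apex has
  \<open>a v = 0\<close> or a neighbour \<open>w\<close> with \<open>a v + a w \<le> k + 1\<close>, and this bounds the degree of \<open>a\<close>. The vanishing
  of Koszul homology passes to kernels with a shift by one. This bounds the shifts of every
  minimal resolution, and it shows that each syzygy module is finitely generated, so that minimal
  resolutions exist without an appeal to Hilbert's basis theorem.
\<close>

section \<open>Monomials and polynomials\<close>

text \<open>\<open>graded_betti\<close> reads its numbers off a resolution picked by
  \<open>SOME\<close>. Existence makes this choice meaningful, and every bound is proved for an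
  arbitrary minimal resolution, hence for the chosen one. Shifts \<open>d\<close> in step
  \<open>i\<close> are bounded on both sides, \<open>i \<le> d \<le> r + i\<close>: the lower bound
  matters as well, since it confines all differences to the interval from 0 to \<open>r\<close>, so
  that the maximum in \<open>regularity\<close> is over a finite set. Koszul homology enters only
  through its vanishing, as the predicate \<open>reg_le\<close> on graded submodules of free
  modules. This one predicate serves three purposes: for \<open>p = 0\<close> it bounds degrees of
  generators, a diagram chase carries it from the image of a map to the kernel, and for monomial
  ideals an explicit contracting homotopy verifies it. The upper bound \<open>k * (n - 1)\<close> is
  a property of every finite simple graph on \<open>n > 0\<close> vertices. The cone vertex acts in
  the lower bound: its edges force the full exponent \<open>k\<close> at each vertex of
  \<open>H\<close>.\<close>

lemma mon_degree_eq_sum: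
  assumes "finite W" "Poly_Mapping.keys m \<subseteq> W"
  shows "mon_degree m = (\<Sum>v\<in>W. Poly_Mapping.lookup m v)"
  unfolding mon_degree_def
  by (rule sum.mono_neutral_left) (use assms in \<open>auto simp: in_keys_iff\<close>)

lemma mon_keys_add:
  fixes m m' :: "'v mon"
  shows "Poly_Mapping.keys (m + m') = Poly_Mapping.keys m \<union> Poly_Mapping.keys m'"
  by (auto simp: in_keys_iff lookup_add)

lemma mon_degree_add: "mon_degree (m + m') = mon_degree m + mon_degree m'"
proof -
  let ?W = "Poly_Mapping.keys m \<union> Poly_Mapping.keys m'"
  have "mon_degree (m + m') = (\<Sum>v\<in>?W. Poly_Mapping.lookup (m + m') v)"
    by (rule mon_degree_eq_sum) (auto simp: mon_keys_add)
  also have "\<dots> = mon_degree m + mon_degree m'"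
    by (subst (1 2) mon_degree_eq_sum[of ?W]) (auto simp: lookup_add sum.distrib)
  finally show ?thesis .
qed

lemma mon_degree_zero [simp]: "mon_degree 0 = 0"
  by (simp add: mon_degree_def)

lemma mon_degree_single [simp]: "mon_degree (Poly_Mapping.single v c) = c"
  by (simp add: mon_degree_def)

lemma mon_degree_eq_0_iff: "mon_degree m = 0 \<longleftrightarrow> m = 0"
  by (auto simp: mon_degree_def poly_mapping_eq_iff in_keys_iff fun_eq_iff)

lemma mon_split_single:
  fixes m :: "'v mon"
  assumes "Poly_Mapping.lookup m v > 0"
  obtains m' where "m = m' + Poly_Mapping.single v 1"
proof
  show "m = (m - Poly_Mapping.single v 1) + Poly_Mapping.single v 1"
    using assms by (intro poly_mapping_eqI) (auto simp: lookup_add lookup_minus lookup_single when_def)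
qed

lemma mon_minus_single_add:
  fixes m :: "'v mon"
  assumes "Poly_Mapping.lookup m v > 0"
  shows "(m - Poly_Mapping.single v 1) + Poly_Mapping.single v 1 = m"
  using assms by (intro poly_mapping_eqI) (auto simp: lookup_add lookup_minus lookup_single when_def)

lemma in_keys_multE:
  assumes "m \<in> Poly_Mapping.keys (p * q)"
  obtains a b where "a \<in> Poly_Mapping.keys p" "b \<in> Poly_Mapping.keys q" "m = a + b"
  using assms keys_mult[of p q] by blast

lemma in_keys_sumE:
  assumes "m \<in> Poly_Mapping.keys (sum f A)"
  obtains x where "x \<in> A" "m \<in> Poly_Mapping.keys (f x)"
proof -
  have "\<exists>x\<in>A. Poly_Mapping.lookup (f x) m \<noteq> 0"
    using assms by (auto simp: in_keys_iff lookup_sum dest: sum.not_neutral_contains_not_neutral)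
  thus ?thesis using that by (auto simp: in_keys_iff)
qed

lemma lookup_single_mult_add:
  fixes q :: "('v, 'k::field) mpoly"
  shows "Poly_Mapping.lookup (Poly_Mapping.single a c * q) (a + m) = c * Poly_Mapping.lookup q m"
  by (simp add: lookup_mult lookup_single when_mult)

lemma lookup_var_mult:
  fixes q :: "('v, 'k::field) mpoly"
  shows "Poly_Mapping.lookup (var v * q) m =
    (if Poly_Mapping.lookup m v = 0 then 0 else Poly_Mapping.lookup q (m - Poly_Mapping.single v 1))"
proof (cases "Poly_Mapping.lookup m v = 0")
  case True
  have "m \<notin> Poly_Mapping.keys (var v * q)"
    using True by (auto simp: var_def monomial_def lookup_add elim!: in_keys_multE split: if_splits)
  thus ?thesis using True by (simp add: in_keys_iff)
next
  case False
  hence "m = Poly_Mapping.single v 1 + (m - Poly_Mapping.single v 1)"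
    using mon_minus_single_add[of m v] by (simp add: add.commute)
  hence "Poly_Mapping.lookup (var v * q) m
      = Poly_Mapping.lookup (var v * q) (Poly_Mapping.single v 1 + (m - Poly_Mapping.single v 1))"
    by simp
  also have "\<dots> = Poly_Mapping.lookup q (m - Poly_Mapping.single v 1)"
    unfolding var_def monomial_def lookup_single_mult_add by simp
  finally show ?thesis using False by simp
qed

lemma poly_carrierI: "(\<And>m. m \<in> Poly_Mapping.keys p \<Longrightarrow> Poly_Mapping.keys m \<subseteq> V) \<Longrightarrow> p \<in> poly_carrier V"
  by (auto simp: poly_carrier_def)

lemma poly_carrierD: "p \<in> poly_carrier V \<Longrightarrow> m \<in> Poly_Mapping.keys p \<Longrightarrow> Poly_Mapping.keys m \<subseteq> V"
  by (auto simp: poly_carrier_def)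

lemma poly_carrier_0 [simp]: "0 \<in> poly_carrier V"
  by (auto simp: poly_carrier_def)

lemma poly_carrier_single: "Poly_Mapping.keys m \<subseteq> V \<Longrightarrow> Poly_Mapping.single m c \<in> poly_carrier V"
  by (auto simp: poly_carrier_def)

lemma poly_carrier_1 [simp]: "1 \<in> poly_carrier V"
  by (auto simp: poly_carrier_def)

lemma poly_carrier_add: "p \<in> poly_carrier V \<Longrightarrow> q \<in> poly_carrier V \<Longrightarrow> p + q \<in> poly_carrier V"
  using keys_add[of p q] by (auto simp: poly_carrier_def)

lemma poly_carrier_mult: "p \<in> poly_carrier V \<Longrightarrow> q \<in> poly_carrier V \<Longrightarrow> p * q \<in> poly_carrier V"
  by (rule poly_carrierI) (auto elim!: in_keys_multE simp: mon_keys_add dest!: poly_carrierD)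

lemma poly_carrier_uminus: "p \<in> poly_carrier V \<Longrightarrow> - p \<in> poly_carrier V"
  by (auto simp: poly_carrier_def in_keys_iff)

lemma poly_carrier_sum: "(\<And>x. x \<in> A \<Longrightarrow> f x \<in> poly_carrier V) \<Longrightarrow> sum f A \<in> poly_carrier V"
  by (rule poly_carrierI) (auto elim!: in_keys_sumE dest: poly_carrierD)

lemma poly_carrier_var: "v \<in> V \<Longrightarrow> var v \<in> poly_carrier V"
  by (auto simp: var_def monomial_def intro!: poly_carrier_single)

lemmas poly_carrier_intros = poly_carrier_0 poly_carrier_1 poly_carrier_add poly_carrier_mult
  poly_carrier_uminus poly_carrier_sum poly_carrier_var

section \<open>Selecting terms of a polynomial, in particular graded components\<close>

lift_definition poly_filter :: "('a \<Rightarrow> bool) \<Rightarrow> ('a \<Rightarrow>\<^sub>0 'b::zero) \<Rightarrow> ('a \<Rightarrow>\<^sub>0 'b)"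
  is "\<lambda>P f m. if P m then f m else 0"
  by (rule finite_subset) auto

lemma lookup_poly_filter: "Poly_Mapping.lookup (poly_filter P p) m = (if P m then Poly_Mapping.lookup p m else 0)"
  by transfer simp

lemma keys_poly_filter: "Poly_Mapping.keys (poly_filter P p) = {m \<in> Poly_Mapping.keys p. P m}"
  by (auto simp: in_keys_iff lookup_poly_filter split: if_splits)

lemma poly_filter_add:
  fixes p q :: "'a \<Rightarrow>\<^sub>0 'b::monoid_add"
  shows "poly_filter P (p + q) = poly_filter P p + poly_filter P q"
  by (intro poly_mapping_eqI) (simp add: lookup_poly_filter lookup_add)

lemma poly_filter_sum:
  fixes f :: "'c \<Rightarrow> 'a \<Rightarrow>\<^sub>0 'b::comm_monoid_add"
  shows "poly_filter P (sum f A) = (\<Sum>x\<in>A. poly_filter P (f x))"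
  by (intro poly_mapping_eqI) (simp add: lookup_poly_filter lookup_sum)

lemma poly_filter_carrier: "p \<in> poly_carrier V \<Longrightarrow> poly_filter P p \<in> poly_carrier V"
  by (auto simp: poly_carrier_def keys_poly_filter)

text \<open>Meant for a homogeneous factor \<open>p\<close>: its monomials all shift the degree by
  the same amount, so selecting a degree in the product is selecting a shifted degree in
  \<open>q\<close>. Splitting \<open>q\<close> by \<open>Q\<close> gives one product lying inside
  \<open>P\<close> and one lying outside.\<close>

lemma poly_filter_mult:
  fixes p q :: "('v, 'k::field) mpoly"
  assumes "\<And>a b. a \<in> Poly_Mapping.keys p \<Longrightarrow> b \<in> Poly_Mapping.keys q \<Longrightarrow> P (a + b) \<longleftrightarrow> Q b"
  shows "poly_filter P (p * q) = p * poly_filter Q q"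
proof -
  have q: "q = poly_filter Q q + poly_filter (\<lambda>m. \<not> Q m) q"
    by (intro poly_mapping_eqI) (simp add: lookup_poly_filter lookup_add)
  have 1: "poly_filter P (p * poly_filter Q q) = p * poly_filter Q q"
  proof (intro poly_mapping_eqI)
    fix m
    have "P m" if "m \<in> Poly_Mapping.keys (p * poly_filter Q q)"
      using that assms by (elim in_keys_multE) (auto simp: keys_poly_filter)
    thus "Poly_Mapping.lookup (poly_filter P (p * poly_filter Q q)) m
        = Poly_Mapping.lookup (p * poly_filter Q q) m"
      by (auto simp: lookup_poly_filter in_keys_iff)
  qed
  have 2: "poly_filter P (p * poly_filter (\<lambda>m. \<not> Q m) q) = 0"
  proof (intro poly_mapping_eqI)
    fix m
    have "\<not> P m" if "m \<in> Poly_Mapping.keys (p * poly_filter (\<lambda>m. \<not> Q m) q)"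
      using that assms by (elim in_keys_multE) (auto simp: keys_poly_filter)
    thus "Poly_Mapping.lookup (poly_filter P (p * poly_filter (\<lambda>m. \<not> Q m) q)) m
        = Poly_Mapping.lookup 0 m"
      by (auto simp: lookup_poly_filter in_keys_iff)
  qed
  have "poly_filter P (p * q) = poly_filter P (p * poly_filter Q q + p * poly_filter (\<lambda>m. \<not> Q m) q)"
    by (subst q) (simp only: distrib_left)
  also have "\<dots> = p * poly_filter Q q"
    by (simp add: poly_filter_add 1 2)
  finally show ?thesis .
qed


section \<open>The Koszul complex\<close>

text \<open>The sign that sorts \<open>v\<close> into its place in the exterior product of the
  elements of \<open>\<sigma>\<close>, in the order given by \<open>rk\<close>.\<close>

definition koszul_sign :: "('v \<Rightarrow> nat) \<Rightarrow> 'v \<Rightarrow> 'v set \<Rightarrow> 'a::ring_1" where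
  "koszul_sign rk v \<sigma> = (if even (card {u \<in> \<sigma>. rk u < rk v}) then 1 else - 1)"

definition squarefree_mon :: "'v set \<Rightarrow> 'v mon" where
  "squarefree_mon \<sigma> = (\<Sum>v\<in>\<sigma>. Poly_Mapping.single v 1)"

lemma koszul_sign_square_mult [simp]: "koszul_sign rk v \<sigma> * (koszul_sign rk v \<sigma> * c) = c"
  by (simp add: koszul_sign_def)

lemma koszul_sign_empty [simp]: "koszul_sign rk v {} = 1"
  by (simp add: koszul_sign_def)

lemma koszul_sign_carrier [simp]: "koszul_sign rk v \<sigma> \<in> poly_carrier V"
  by (auto simp: koszul_sign_def intro: poly_carrier_intros)

lemma lookup_koszul_sign_mult [simp]:
  fixes p :: "('v, 'k::field) mpoly"
  shows "Poly_Mapping.lookup (koszul_sign rk v \<sigma> * p) m = koszul_sign rk v \<sigma> * Poly_Mapping.lookup p m"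
  by (simp add: koszul_sign_def)

lemma squarefree_mon_insert:
  "finite \<sigma> \<Longrightarrow> v \<notin> \<sigma> \<Longrightarrow> squarefree_mon (insert v \<sigma>) = Poly_Mapping.single v 1 + squarefree_mon \<sigma>"
  by (simp add: squarefree_mon_def)

lemma squarefree_mon_remove:
  "finite \<sigma> \<Longrightarrow> v \<in> \<sigma> \<Longrightarrow> squarefree_mon \<sigma> = Poly_Mapping.single v 1 + squarefree_mon (\<sigma> - {v})"
  by (simp add: squarefree_mon_def sum.remove)

lemma lookup_squarefree_mon:
  "finite \<sigma> \<Longrightarrow> Poly_Mapping.lookup (squarefree_mon \<sigma>) v = (if v \<in> \<sigma> then 1 else 0)"
  by (simp add: squarefree_mon_def lookup_sum lookup_single when_def)

lemma mon_degree_squarefree_mon: "finite \<sigma> \<Longrightarrow> mon_degree (squarefree_mon \<sigma>) = card \<sigma>"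
  by (induction \<sigma> rule: finite_induct)
     (auto simp: squarefree_mon_insert mon_degree_add, simp add: squarefree_mon_def)

text \<open>The type of vertices carries no order, so the Koszul signs refer to an arbitrary
  injective ranking of the finitely many variables.\<close>

locale ranked_vars =
  fixes V :: "'v set" and rk :: "'v \<Rightarrow> nat"
  assumes fin: "finite V" and inj: "inj_on rk V"
begin

text \<open>If \<open>v\<close> ranks below \<open>w\<close>, inserting \<open>v\<close> raises the
  count for \<open>w\<close> by one while inserting \<open>w\<close> leaves the count for
  \<open>v\<close> alone; the other case is symmetric. Both the vanishing of the squared boundary
  and the cone homotopy rest on this sign.\<close>

lemma koszul_sign_antisym:
  assumes "v \<in> V" "w \<in> V" "v \<noteq> w" "v \<notin> \<sigma>" "w \<notin> \<sigma>" "finite \<sigma>"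
  shows "koszul_sign rk v \<sigma> * koszul_sign rk w (insert v \<sigma>)
       = - (koszul_sign rk w \<sigma> * koszul_sign rk v (insert w \<sigma>) :: 'a::comm_ring_1)"
proof -
  have aux: "koszul_sign rk v \<sigma> * koszul_sign rk w (insert v \<sigma>)
       = - (koszul_sign rk w \<sigma> * koszul_sign rk v (insert w \<sigma>) :: 'a)"
    if "v \<notin> \<sigma>" "w \<notin> \<sigma>" "rk v < rk w" for v w
  proof -
    have "{u \<in> insert v \<sigma>. rk u < rk w} = insert v {u \<in> \<sigma>. rk u < rk w}"
      and "{u \<in> insert w \<sigma>. rk u < rk v} = {u \<in> \<sigma>. rk u < rk v}"
      using that by auto
    thus ?thesis
      using that assms(6) by (simp add: koszul_sign_def)
  qed
  have "rk v \<noteq> rk w" using assms inj by (auto simp: inj_on_def)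
  then consider "rk v < rk w" | "rk w < rk v" by linarith
  thus ?thesis
  proof cases
    case 1
    thus ?thesis using aux assms by blast
  next
    case 2
    thus ?thesis using aux[of w v] assms by simp
  qed
qed

text \<open>
  In a multidegree \<open>a\<close> the Koszul complex of the monomial ideal spanned by \<open>U\<close> is the chain complex
  of the simplicial complex of all \<open>\<sigma>\<close> with \<open>a - \<sigma> \<in> U\<close>. The predicate says that this complex is a
  cone as far as its faces of cardinality \<open>p\<close> are concerned.
\<close>

definition coned :: "'v mon set \<Rightarrow> nat \<Rightarrow> nat \<Rightarrow> bool" where
  "coned U d p \<longleftrightarrow> (\<forall>m\<in>U. \<forall>\<sigma>\<subseteq>V. mon_degree m = d \<and> card \<sigma> = p \<longrightarrow>
     (\<exists>v\<in>V. \<forall>m'\<in>U. \<forall>\<tau>\<subseteq>V. card \<tau> = p \<and> m' + squarefree_mon \<tau> = m + squarefree_mon \<sigma> \<and> v \<notin> \<tau>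
        \<longrightarrow> (\<exists>m''\<in>U. m' = m'' + Poly_Mapping.single v 1)))"

text \<open>The contracting homotopy of a cone: \<open>g\<close> joins each face with the apex, and
  the boundary of this join is \<open>f\<close> minus the join with the boundary of
  \<open>f\<close>, which is zero. All multidegrees are treated at once; the apex depends only on
  \<open>m + squarefree_mon \<sigma>\<close>, which the boundary preserves.\<close>

lemma coned_boundary:
  fixes f :: "'v set \<Rightarrow> ('v, 'k::field) mpoly"
  assumes supp: "\<And>\<sigma> m. m \<in> Poly_Mapping.keys (f \<sigma>) \<Longrightarrow>
      \<sigma> \<subseteq> V \<and> card \<sigma> = p \<and> m \<in> U \<and> mon_degree m = Suc e"
    and cycle: "\<And>\<sigma>. (\<Sum>v\<in>V - \<sigma>. koszul_sign rk v \<sigma> * (var v * f (insert v \<sigma>))) = 0"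
    and cone: "coned U (Suc e) p"
  shows "\<exists>g :: 'v set \<Rightarrow> ('v, 'k) mpoly.
    (\<forall>\<sigma> m. m \<in> Poly_Mapping.keys (g \<sigma>) \<longrightarrow> \<sigma> \<subseteq> V \<and> card \<sigma> = Suc p \<and> m \<in> U \<and> mon_degree m = e) \<and>
    (\<forall>\<sigma>. (\<Sum>v\<in>V - \<sigma>. koszul_sign rk v \<sigma> * (var v * g (insert v \<sigma>))) = f \<sigma>)"
proof -
  define apex_of where "apex_of a v \<longleftrightarrow> v \<in> V \<and> (\<forall>m'\<in>U. \<forall>\<tau>\<subseteq>V. card \<tau> = p \<and> m' + squarefree_mon \<tau> = a
    \<and> v \<notin> \<tau> \<longrightarrow> (\<exists>m''\<in>U. m' = m'' + Poly_Mapping.single v 1))" for a v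
  define apex where "apex a = (SOME v. apex_of a v)" for a
  have apex: "apex_of (m + squarefree_mon \<sigma>) (apex (m + squarefree_mon \<sigma>))"
    if "m \<in> Poly_Mapping.keys (f \<sigma>)" for m \<sigma>
  proof -
    have "\<exists>v. apex_of (m + squarefree_mon \<sigma>) v"
      using supp[OF that] cone unfolding apex_of_def coned_def by metis
    thus ?thesis unfolding apex_def by (rule someI_ex)
  qed
  \<comment> \<open>The join with the apex: a face containing \<open>v\<close> takes the coefficient
    of the face without it, and the multidegree is kept by moving one factor \<open>v\<close> from
    the monomial to the face. In multidegrees without terms of \<open>f\<close> the value of
    \<open>apex\<close> is arbitrary; the intersection with \<open>V\<close> still leaves only
    finitely many candidates, which makes the support finite.\<close>
  define G where "G \<sigma> m = (let v = apex (m + squarefree_mon \<sigma>) in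
    if v \<in> \<sigma> \<inter> V then koszul_sign rk v (\<sigma> - {v}) * Poly_Mapping.lookup (f (\<sigma> - {v})) (m + Poly_Mapping.single v 1)
    else 0)" for \<sigma> m
  define g where "g \<sigma> = Abs_poly_mapping (G \<sigma>)" for \<sigma>
  have "finite {m. G \<sigma> m \<noteq> 0}" for \<sigma>
  proof (rule finite_subset)
    show "{m. G \<sigma> m \<noteq> 0} \<subseteq> (\<Union>v\<in>V. (\<lambda>m. m + Poly_Mapping.single v 1) -` Poly_Mapping.keys (f (\<sigma> - {v})))"
      by (auto simp: G_def Let_def in_keys_iff split: if_splits)
    show "finite (\<Union>v\<in>V. (\<lambda>m. m + Poly_Mapping.single v 1) -` Poly_Mapping.keys (f (\<sigma> - {v})))"
      using fin by (intro finite_UN_I finite_vimageI) (auto simp: inj_def)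
  qed
  hence lookup_g: "Poly_Mapping.lookup (g \<sigma>) m = G \<sigma> m" for \<sigma> m
    by (simp add: g_def)
  have supp_g: "\<sigma> \<subseteq> V \<and> card \<sigma> = Suc p \<and> m \<in> U \<and> mon_degree m = e"
    if "m \<in> Poly_Mapping.keys (g \<sigma>)" for \<sigma> m
  proof -
    define v where "v = apex (m + squarefree_mon \<sigma>)"
    have v: "v \<in> \<sigma>" "v \<in> V" and k: "m + Poly_Mapping.single v 1 \<in> Poly_Mapping.keys (f (\<sigma> - {v}))"
      using that by (auto simp: in_keys_iff lookup_g G_def v_def Let_def split: if_splits)
    note s = supp[OF k]
    have sub: "\<sigma> \<subseteq> V" using s v by blast
    have fins: "finite \<sigma>" using sub fin finite_subset by blast
    have card: "card \<sigma> = Suc p" using s fins v by (metis card_Suc_Diff1)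
    have a: "m + Poly_Mapping.single v 1 + squarefree_mon (\<sigma> - {v}) = m + squarefree_mon \<sigma>"
      using squarefree_mon_remove[OF fins v(1)] by (simp add: add.assoc)
    have "apex_of (m + squarefree_mon \<sigma>) v"
      using apex[OF k] a v_def by simp
    hence "\<exists>m''\<in>U. m + Poly_Mapping.single v 1 = m'' + Poly_Mapping.single v 1"
      using s a unfolding apex_of_def by blast
    hence "m \<in> U" by auto
    moreover have "mon_degree m = e" using s by (simp add: mon_degree_add)
    ultimately show ?thesis using sub card by blast
  qed
  have bd_g: "(\<Sum>v\<in>V - \<tau>. koszul_sign rk v \<tau> * (var v * g (insert v \<tau>))) = f \<tau>" for \<tau>
  proof (cases "\<tau> \<subseteq> V")
    case False
    hence "f \<tau> = 0" "g (insert w \<tau>) = 0" for w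
      using supp[of _ \<tau>] supp_g[of _ "insert w \<tau>"] by (auto simp flip: keys_eq_empty)
    thus ?thesis by simp
  next
    case True
    hence fint: "finite \<tau>" using fin finite_subset by blast
    show ?thesis
    proof (rule poly_mapping_eqI)
      fix m
      define a where "a = m + squarefree_mon \<tau>"
      define v where "v = apex a"
      \<comment> \<open>All terms of the boundary at \<open>\<tau>\<close> and \<open>m\<close> lie
        in the single multidegree \<open>a\<close>, so one vertex \<open>v\<close> governs all of
        them.\<close>
      let ?L = "\<Sum>w\<in>V - \<tau>. koszul_sign rk w \<tau> * (if Poly_Mapping.lookup m w = 0 then 0 else
         if v \<in> insert w \<tau> \<inter> V then koszul_sign rk v (insert w \<tau> - {v}) *
            Poly_Mapping.lookup (f (insert w \<tau> - {v})) (m - Poly_Mapping.single w 1 + Poly_Mapping.single v 1)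
         else 0)"
      have a_w: "m - Poly_Mapping.single w 1 + squarefree_mon (insert w \<tau>) = a"
        if "w \<in> V - \<tau>" "Poly_Mapping.lookup m w \<noteq> 0" for w
        using that fint mon_minus_single_add[of m w]
        by (simp add: squarefree_mon_insert a_def add.assoc[symmetric])
      have "Poly_Mapping.lookup (\<Sum>w\<in>V - \<tau>. koszul_sign rk w \<tau> * (var w * g (insert w \<tau>))) m = ?L"
        unfolding lookup_sum lookup_koszul_sign_mult lookup_var_mult lookup_g
        by (rule sum.cong) (use a_w in \<open>auto simp: G_def v_def Let_def\<close>)
      also have "?L = Poly_Mapping.lookup (f \<tau>) m"
      proof (cases "\<exists>m' \<sigma>. m' \<in> Poly_Mapping.keys (f \<sigma>) \<and> m' + squarefree_mon \<sigma> = a")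
        \<comment> \<open>Here \<open>v\<close> need not be an apex, but \<open>f\<close> has no
          term in this multidegree and both sides vanish.\<close>
        case False
        hence z: "Poly_Mapping.lookup (f \<sigma>) m' = 0" if "m' + squarefree_mon \<sigma> = a" for m' \<sigma>
          using that by (auto simp: in_keys_iff)
        have "m - Poly_Mapping.single w 1 + Poly_Mapping.single v 1 + squarefree_mon (insert w \<tau> - {v}) = a"
          if "w \<in> V - \<tau>" "Poly_Mapping.lookup m w \<noteq> 0" "v \<in> insert w \<tau>" for w
          using squarefree_mon_remove[of "insert w \<tau>" v] a_w[of w] fint that by (simp add: add.assoc)
        hence z': "Poly_Mapping.lookup (f (insert w \<tau> - {v})) (m - Poly_Mapping.single w 1 + Poly_Mapping.single v 1) = 0"
          if "w \<in> V - \<tau>" "Poly_Mapping.lookup m w \<noteq> 0" "v \<in> insert w \<tau>" for w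
          using that by (intro z)
        have "?L = (\<Sum>w\<in>V - \<tau>. 0)"
        proof (rule sum.cong[OF refl])
          fix w assume w: "w \<in> V - \<tau>"
          show "koszul_sign rk w \<tau> * (if Poly_Mapping.lookup m w = 0 then 0 else
             if v \<in> insert w \<tau> \<inter> V then koszul_sign rk v (insert w \<tau> - {v}) *
                Poly_Mapping.lookup (f (insert w \<tau> - {v})) (m - Poly_Mapping.single w 1 + Poly_Mapping.single v 1)
             else 0) = 0"
          proof (cases "Poly_Mapping.lookup m w \<noteq> 0 \<and> v \<in> insert w \<tau>")
            case True
            show ?thesis
              unfolding z'[OF w conjunct1[OF True] conjunct2[OF True]] by (simp only: mult_zero_right if_cancel)
          next
            case False
            thus ?thesis by auto
          qed
        qed
        hence "?L = 0" by simp
        thus ?thesis using z[of m \<tau>] a_def by simp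
      next
        case True
        hence av: "apex_of a v" using apex v_def by metis
        hence vV: "v \<in> V" by (simp add: apex_of_def)
        show ?thesis
        proof (cases "v \<in> \<tau>")
          \<comment> \<open>Among the faces \<open>insert w \<tau>\<close> only the one with
            \<open>w = v\<close> contains the apex, and its two equal signs cancel. If
            \<open>v\<close> does not divide \<open>m\<close>, that term is zero, and so is the
            coefficient of \<open>f\<close>, because the apex property would make \<open>v\<close>
            divide \<open>m\<close>.\<close>
          case False
          have "?L = (\<Sum>w\<in>V - \<tau>. if w = v then Poly_Mapping.lookup (f \<tau>) m else 0)"
          proof (rule sum.cong[OF refl])
            fix w assume w: "w \<in> V - \<tau>"
            show "koszul_sign rk w \<tau> * (if Poly_Mapping.lookup m w = 0 then 0 else
               if v \<in> insert w \<tau> \<inter> V then koszul_sign rk v (insert w \<tau> - {v}) *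
                  Poly_Mapping.lookup (f (insert w \<tau> - {v})) (m - Poly_Mapping.single w 1 + Poly_Mapping.single v 1)
               else 0) = (if w = v then Poly_Mapping.lookup (f \<tau>) m else 0)"
            proof (cases "w = v")
              case wv: True
              have ins: "insert v \<tau> - {v} = \<tau>" using False by auto
              show ?thesis
              proof (cases "Poly_Mapping.lookup m v = 0")
                case True
                have "m \<notin> Poly_Mapping.keys (f \<tau>)"
                proof
                  assume "m \<in> Poly_Mapping.keys (f \<tau>)"
                  hence "\<exists>m''\<in>U. m = m'' + Poly_Mapping.single v 1"
                    using supp av False a_def unfolding apex_of_def by blast
                  thus False using True by (auto simp: lookup_add)
                qed
                thus ?thesis using True wv by (auto simp: in_keys_iff)
              next
                case nz: False
                show ?thesis
                  using wv nz vV mon_minus_single_add[of m v] by (simp add: ins)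
              qed
            next
              case nv: False
              thus ?thesis using False by auto
            qed
          qed
          also have "\<dots> = Poly_Mapping.lookup (f \<tau>) m"
            using False vV fin by simp
          finally show ?thesis .
        next
          \<comment> \<open>The cycle condition at \<open>\<tau> - {v}\<close>, read at the monomial
            \<open>m + Poly_Mapping.single v 1\<close>, stays in multidegree \<open>a\<close>. It
            expresses the coefficient of \<open>f\<close> at \<open>\<tau>\<close> through the faces
            that exchange \<open>v\<close> for \<open>w\<close>, and these are the terms of
            \<open>?L\<close>.\<close>
          case True
          define \<sigma> where "\<sigma> = \<tau> - {v}"
          have \<tau>: "\<tau> = insert v \<sigma>" "v \<notin> \<sigma>" "finite \<sigma>" using True fint by (auto simp: \<sigma>_def)
          let ?c = "\<lambda>w. if Poly_Mapping.lookup m w = 0 then 0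
              else Poly_Mapping.lookup (f (insert w \<sigma>)) (m - Poly_Mapping.single w 1 + Poly_Mapping.single v 1)"
          have swap: "m + Poly_Mapping.single v 1 - Poly_Mapping.single w 1
              = m - Poly_Mapping.single w 1 + Poly_Mapping.single v 1"
            if "Poly_Mapping.lookup m w \<noteq> 0" for w
            using that by (intro poly_mapping_eqI) (auto simp: lookup_add lookup_minus lookup_single when_def)
          have "0 = Poly_Mapping.lookup (\<Sum>w\<in>V - \<sigma>. koszul_sign rk w \<sigma> * (var w * f (insert w \<sigma>)))
              (m + Poly_Mapping.single v 1)"
            by (simp add: cycle)
          also have "V - \<sigma> = insert v (V - \<tau>)" using \<tau> vV by auto
          also have "Poly_Mapping.lookup (\<Sum>w\<in>insert v (V - \<tau>). koszul_sign rk w \<sigma> * (var w * f (insert w \<sigma>)))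
              (m + Poly_Mapping.single v 1)
            = koszul_sign rk v \<sigma> * Poly_Mapping.lookup (f \<tau>) m + (\<Sum>w\<in>V - \<tau>. koszul_sign rk w \<sigma> * ?c w)"
          proof -
            have "(\<Sum>w\<in>V - \<tau>. Poly_Mapping.lookup (koszul_sign rk w \<sigma> * (var w * f (insert w \<sigma>)))
                (m + Poly_Mapping.single v 1)) = (\<Sum>w\<in>V - \<tau>. koszul_sign rk w \<sigma> * ?c w)"
              unfolding lookup_koszul_sign_mult lookup_var_mult
              by (rule sum.cong) (use True in \<open>auto simp: lookup_add lookup_single when_def swap[simplified]\<close>)
            thus ?thesis
              using fin True by (simp add: lookup_sum lookup_var_mult lookup_add \<tau>(1)[symmetric])
          qed
          finally have "- (koszul_sign rk v \<sigma> * Poly_Mapping.lookup (f \<tau>) m) = (\<Sum>w\<in>V - \<tau>. koszul_sign rk w \<sigma> * ?c w)"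
            by (simp add: add_eq_0_iff)
          hence "koszul_sign rk v \<sigma> * (koszul_sign rk v \<sigma> * Poly_Mapping.lookup (f \<tau>) m)
              = - (koszul_sign rk v \<sigma> * (\<Sum>w\<in>V - \<tau>. koszul_sign rk w \<sigma> * ?c w))"
            by (metis minus_mult_right minus_minus)
          hence "Poly_Mapping.lookup (f \<tau>) m = (\<Sum>w\<in>V - \<tau>. - (koszul_sign rk v \<sigma> * koszul_sign rk w \<sigma>) * ?c w)"
            by (simp add: sum_distrib_left sum_negf mult.assoc)
          also have "\<dots> = ?L"
          proof (rule sum.cong[OF refl])
            fix w assume w: "w \<in> V - \<tau>"
            hence wv: "w \<noteq> v" "w \<notin> \<sigma>" "w \<in> V" using True \<sigma>_def by auto
            have ins: "insert w \<tau> - {v} = insert w \<sigma>" using wv \<tau> by auto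
            have "koszul_sign rk v \<sigma> * koszul_sign rk w \<tau>
                = - (koszul_sign rk w \<sigma> * koszul_sign rk v (insert w \<sigma>) :: 'k)"
              using koszul_sign_antisym[of v w \<sigma>] \<tau> wv vV by metis
            hence sg: "- (koszul_sign rk v \<sigma> * koszul_sign rk w \<sigma>)
                = (koszul_sign rk w \<tau> * koszul_sign rk v (insert w \<sigma>) :: 'k)"
              unfolding koszul_sign_def by (auto split: if_splits)
            show "- (koszul_sign rk v \<sigma> * koszul_sign rk w \<sigma>) * ?c w
              = koszul_sign rk w \<tau> * (if Poly_Mapping.lookup m w = 0 then 0 else
               if v \<in> insert w \<tau> \<inter> V then koszul_sign rk v (insert w \<tau> - {v}) *
                  Poly_Mapping.lookup (f (insert w \<tau> - {v})) (m - Poly_Mapping.single w 1 + Poly_Mapping.single v 1)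
               else 0)"
              unfolding sg ins using True vV by (simp add: mult.assoc)
          qed
          finally show ?thesis by simp
        qed
      qed
      finally show "Poly_Mapping.lookup (\<Sum>w\<in>V - \<tau>. koszul_sign rk w \<tau> * (var w * g (insert w \<tau>))) m
          = Poly_Mapping.lookup (f \<tau>) m" .
    qed
  qed
  show ?thesis
    by (intro exI[of _ g] conjI allI impI) (use supp_g bd_g in simp_all)
qed

text \<open>
  Free modules are modelled by functions instead of vectors, because functions form a type of class
  \<open>ab_group_add\<close>.
\<close>

definition fmod :: "nat \<Rightarrow> (nat \<Rightarrow> ('v, 'k::field) mpoly) set" where
  "fmod n = {u. (\<forall>j. u j \<in> poly_carrier V) \<and> (\<forall>j\<ge>n. u j = 0)}"

definition hom_elem :: "nat list \<Rightarrow> nat \<Rightarrow> (nat \<Rightarrow> ('v, 'k::field) mpoly) \<Rightarrow> bool" where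
  "hom_elem t d u \<longleftrightarrow> (\<forall>j<length t. \<forall>m\<in>Poly_Mapping.keys (u j). mon_degree m + t ! j = d)"

definition koszul_bd :: "('v set \<Rightarrow> nat \<Rightarrow> ('v, 'k::field) mpoly) \<Rightarrow> 'v set \<Rightarrow> nat \<Rightarrow> ('v, 'k) mpoly" where
  "koszul_bd f = (\<lambda>\<sigma> j. \<Sum>v\<in>V - \<sigma>. koszul_sign rk v \<sigma> * (var v * f (insert v \<sigma>) j))"

definition koszul_chain ::
  "(nat \<Rightarrow> ('v, 'k::field) mpoly) set \<Rightarrow> nat list \<Rightarrow> nat \<Rightarrow> nat \<Rightarrow> ('v set \<Rightarrow> nat \<Rightarrow> ('v, 'k) mpoly) \<Rightarrow> bool"
where
  "koszul_chain M t d p f \<longleftrightarrow>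
     (\<forall>\<sigma>. if \<sigma> \<subseteq> V \<and> card \<sigma> = p then f \<sigma> \<in> M \<and> hom_elem t d (f \<sigma>) else f \<sigma> = 0)"

text \<open>
  A chain in homological degree \<open>p\<close> with coefficients of degree \<open>e\<close> has total degree \<open>e + p\<close>, so
  the following says that the Koszul homology of \<open>M\<close> vanishes in total degrees above \<open>r + p\<close>: that
  is, \<open>M\<close> has regularity at most \<open>r\<close>.
\<close>

definition reg_le :: "(nat \<Rightarrow> ('v, 'k::field) mpoly) set \<Rightarrow> nat list \<Rightarrow> nat \<Rightarrow> bool" where
  "reg_le M t r \<longleftrightarrow> (\<forall>p e f. r \<le> e \<longrightarrow> koszul_chain M t (Suc e) p f \<longrightarrow> koszul_bd f = 0 \<longrightarrow>
     (\<exists>g. koszul_chain M t e (Suc p) g \<and> koszul_bd g = f))"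

lemma reg_leD:
  assumes "reg_le M t r" "r \<le> e" "koszul_chain M t (Suc e) p f" "koszul_bd f = 0"
  obtains g where "koszul_chain M t e (Suc p) g" "koszul_bd g = f"
  using assms unfolding reg_le_def by blast

lemma koszul_chainD:
  "koszul_chain M t d p f \<Longrightarrow> \<sigma> \<subseteq> V \<Longrightarrow> card \<sigma> = p \<Longrightarrow> f \<sigma> \<in> M"
  "koszul_chain M t d p f \<Longrightarrow> \<sigma> \<subseteq> V \<Longrightarrow> card \<sigma> = p \<Longrightarrow> hom_elem t d (f \<sigma>)"
  "koszul_chain M t d p f \<Longrightarrow> \<not> (\<sigma> \<subseteq> V \<and> card \<sigma> = p) \<Longrightarrow> f \<sigma> = 0"
  unfolding koszul_chain_def by (metis (full_types))+

lemma koszul_chainI: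
  assumes "\<And>\<sigma>. \<sigma> \<subseteq> V \<Longrightarrow> card \<sigma> = p \<Longrightarrow> f \<sigma> \<in> M \<and> hom_elem t d (f \<sigma>)"
    and "\<And>\<sigma>. \<not> (\<sigma> \<subseteq> V \<and> card \<sigma> = p) \<Longrightarrow> f \<sigma> = 0"
  shows "koszul_chain M t d p f"
  using assms unfolding koszul_chain_def by presburger

text \<open>A monomial condition in each coordinate makes the module a direct sum of shifted
  monomial ideals. Its Koszul complex splits accordingly, and \<open>coned_boundary\<close> fills
  each coordinate separately in the degree reduced by \<open>t ! j\<close>;
  \<open>t ! j \<le> e\<close> keeps this subtraction exact.\<close>

lemma reg_le_monomial:
  fixes U :: "nat \<Rightarrow> 'v mon set"
  assumes U: "\<And>j m. m \<in> U j \<Longrightarrow> Poly_Mapping.keys m \<subseteq> V"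
    and cone: "\<And>j e p. j < length t \<Longrightarrow> r \<le> e \<Longrightarrow> t ! j \<le> e \<and> coned (U j) (Suc e - t ! j) p"
  shows "reg_le {u \<in> fmod (length t). \<forall>j<length t. Poly_Mapping.keys (u j :: ('v, 'k::field) mpoly) \<subseteq> U j} t r"
    (is "reg_le ?M t r")
  unfolding reg_le_def
proof (intro allI impI)
  fix p e and f :: "'v set \<Rightarrow> nat \<Rightarrow> ('v, 'k) mpoly"
  assume e: "r \<le> e" and f: "koszul_chain ?M t (Suc e) p f" and cyc: "koszul_bd f = 0"
  let ?P = "\<lambda>j g. (\<forall>\<sigma> m. m \<in> Poly_Mapping.keys (g \<sigma> :: ('v, 'k) mpoly) \<longrightarrow>
      \<sigma> \<subseteq> V \<and> card \<sigma> = Suc p \<and> m \<in> U j \<and> mon_degree m = e - t ! j) \<and>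
    (\<forall>\<sigma>. (\<Sum>v\<in>V - \<sigma>. koszul_sign rk v \<sigma> * (var v * g (insert v \<sigma>))) = f \<sigma> j)"
  have ex: "\<exists>g. ?P j g" if j: "j < length t" for j
  proof -
    have supp: "\<sigma> \<subseteq> V \<and> card \<sigma> = p \<and> m \<in> U j \<and> mon_degree m = Suc (e - t ! j)"
      if m: "m \<in> Poly_Mapping.keys (f \<sigma> j)" for \<sigma> m
    proof -
      have "f \<sigma> \<noteq> 0" using m by auto
      hence s: "\<sigma> \<subseteq> V \<and> card \<sigma> = p"
        using koszul_chainD(3)[OF f, of \<sigma>] by blast
      hence "f \<sigma> \<in> ?M" "hom_elem t (Suc e) (f \<sigma>)"
        using koszul_chainD(1,2)[OF f, of \<sigma>] by auto
      hence "m \<in> U j" "mon_degree m + t ! j = Suc e"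
        using j m by (auto simp: hom_elem_def)
      moreover have "t ! j \<le> e" using cone[OF j e] by blast
      ultimately show ?thesis using s by simp
    qed
    have c: "(\<Sum>v\<in>V - \<sigma>. koszul_sign rk v \<sigma> * (var v * f (insert v \<sigma>) j)) = 0" for \<sigma>
      using fun_cong[OF fun_cong[OF cyc, of \<sigma>], of j] by (simp add: koszul_bd_def)
    have d: "coned (U j) (Suc (e - t ! j)) p"
    proof -
      have "t ! j \<le> e" using cone[OF j e] by blast
      hence "Suc e - t ! j = Suc (e - t ! j)" by (rule Suc_diff_le)
      thus ?thesis using cone[OF j e, of p] by (simp only:)
    qed
    show ?thesis
      by (rule coned_boundary[where f = "\<lambda>\<sigma>. f \<sigma> j", OF supp c d])
  qed
  define G where "G j = (SOME g. ?P j g)" for j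
  have G: "?P j (G j)" if "j < length t" for j
    unfolding G_def by (rule someI_ex[OF ex[OF that]])
  define g where "g \<sigma> j = (if j < length t then G j \<sigma> else 0)" for \<sigma> j
  have "koszul_chain ?M t e (Suc p) g"
  proof (rule koszul_chainI)
    fix \<sigma> assume "\<sigma> \<subseteq> V" "card \<sigma> = Suc p"
    have "g \<sigma> \<in> ?M"
      using G U by (auto simp: fmod_def g_def intro!: poly_carrierI) blast+
    moreover have "hom_elem t e (g \<sigma>)"
      using G cone[OF _ e] by (fastforce simp: hom_elem_def g_def)
    ultimately show "g \<sigma> \<in> ?M \<and> hom_elem t e (g \<sigma>)" ..
  next
    fix \<sigma> assume "\<not> (\<sigma> \<subseteq> V \<and> card \<sigma> = Suc p)"
    hence "Poly_Mapping.keys (G j \<sigma>) = {}" if "j < length t" for j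
      using G[OF that] by blast
    thus "g \<sigma> = 0" by (auto simp: g_def)
  qed
  moreover have "koszul_bd g = f"
  proof (intro ext)
    fix \<sigma> j
    show "koszul_bd g \<sigma> j = f \<sigma> j"
    proof (cases "j < length t")
      case True
      thus ?thesis using G by (simp add: koszul_bd_def g_def)
    next
      case False
      hence "f \<sigma> j = 0"
        using koszul_chainD(1)[OF f, of \<sigma>] koszul_chainD(3)[OF f, of \<sigma>]
        by (cases "\<sigma> \<subseteq> V \<and> card \<sigma> = p") (auto simp: fmod_def)
      thus ?thesis using False by (simp add: koszul_bd_def g_def)
    qed
  qed
  ultimately show "\<exists>g. koszul_chain ?M t e (Suc p) g \<and> koszul_bd g = f" by blast
qed

text \<open>Any variable dividing \<open>m\<close> is an apex: a face that avoids \<open>v\<close>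
  leaves the whole exponent of \<open>v\<close> to the monomial. This is the exactness of the Koszul
  complex of the polynomial ring in positive coefficient degree.\<close>

lemma coned_UNIV:
  assumes "d > 0"
  shows "coned {m. Poly_Mapping.keys m \<subseteq> V} d p"
  unfolding coned_def
proof (intro ballI allI impI)
  fix m \<sigma> assume m: "m \<in> {m. Poly_Mapping.keys m \<subseteq> V}" and s: "\<sigma> \<subseteq> V" "mon_degree m = d \<and> card \<sigma> = p"
  have "m \<noteq> 0" using s assms by auto
  then obtain v where v: "v \<in> Poly_Mapping.keys m" by (metis all_not_in_conv keys_eq_empty)
  show "\<exists>v\<in>V. \<forall>m'\<in>{m. Poly_Mapping.keys m \<subseteq> V}. \<forall>\<tau>\<subseteq>V. card \<tau> = p \<and>
      m' + squarefree_mon \<tau> = m + squarefree_mon \<sigma> \<and> v \<notin> \<tau>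
    \<longrightarrow> (\<exists>m''\<in>{m. Poly_Mapping.keys m \<subseteq> V}. m' = m'' + Poly_Mapping.single v 1)"
  proof (intro bexI[of _ v] ballI allI impI)
    fix m' \<tau> assume m': "m' \<in> {m. Poly_Mapping.keys m \<subseteq> V}" and t: "\<tau> \<subseteq> V"
      and eq: "card \<tau> = p \<and> m' + squarefree_mon \<tau> = m + squarefree_mon \<sigma> \<and> v \<notin> \<tau>"
    have "finite \<tau>" using t fin finite_subset by blast
    hence "Poly_Mapping.lookup (squarefree_mon \<tau>) v = 0"
      using eq by (simp add: lookup_squarefree_mon)
    hence "Poly_Mapping.lookup m' v = Poly_Mapping.lookup (m' + squarefree_mon \<tau>) v"
      by (simp add: lookup_add)
    also have "\<dots> > 0" using eq v by (simp add: lookup_add in_keys_iff)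
    finally obtain m'' where "m' = m'' + Poly_Mapping.single v 1" by (rule mon_split_single)
    thus "\<exists>m''\<in>{m. Poly_Mapping.keys m \<subseteq> V}. m' = m'' + Poly_Mapping.single v 1"
      using m' by (intro bexI[of _ m'']) (auto simp: mon_keys_add)
  qed (use m v in auto)
qed

lemma reg_le_fmod:
  assumes "\<And>j. j < length t \<Longrightarrow> t ! j \<le> r"
  shows "reg_le (fmod (length t) :: (nat \<Rightarrow> ('v, 'k::field) mpoly) set) t r"
proof -
  have "fmod (length t) = {u \<in> fmod (length t). \<forall>j<length t.
      Poly_Mapping.keys (u j :: ('v, 'k) mpoly) \<subseteq> {m. Poly_Mapping.keys m \<subseteq> V}}"
    by (auto simp: fmod_def poly_carrier_def)
  moreover have "t ! j \<le> e \<and> coned {m. Poly_Mapping.keys m \<subseteq> V} (Suc e - t ! j) p"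
    if "j < length t" "r \<le> e" for j e p
    using assms[OF that(1)] that(2) by (auto intro!: coned_UNIV)
  ultimately show ?thesis
    using reg_le_monomial[of "\<lambda>_. {m. Poly_Mapping.keys m \<subseteq> V}" t r, where 'k = 'k] by simp
qed

text \<open>In the double sum, the terms for the ordered pairs \<open>(v, w)\<close> and
  \<open>(w, v)\<close> cancel by \<open>koszul_sign_antisym\<close>; the ranking separates the two
  kinds of pairs.\<close>

lemma koszul_bd_bd:
  fixes f :: "'v set \<Rightarrow> nat \<Rightarrow> ('v, 'k::field) mpoly"
  assumes "\<And>\<sigma>. \<not> \<sigma> \<subseteq> V \<Longrightarrow> f \<sigma> = 0"
  shows "koszul_bd (koszul_bd f) = 0"
proof (intro ext)
  fix \<sigma> j
  show "koszul_bd (koszul_bd f) \<sigma> j = 0 \<sigma> j"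
  proof (cases "\<sigma> \<subseteq> V")
    case False
    hence "f (insert w (insert v \<sigma>)) = 0" for v w by (intro assms) auto
    thus ?thesis by (simp add: koszul_bd_def)
  next
    case True
    hence fins: "finite \<sigma>" using fin finite_subset by blast
    define h where "h v w = (koszul_sign rk v \<sigma> * koszul_sign rk w (insert v \<sigma>)) *
        (var v * var w * f (insert w (insert v \<sigma>)) j)" for v w
    have h: "h v w + h w v = 0" if "v \<in> V - \<sigma>" "w \<in> V - \<sigma>" "v \<noteq> w" for v w
    proof -
      have "h v w = - (koszul_sign rk w \<sigma> * koszul_sign rk v (insert w \<sigma>)) *
        (var w * var v * f (insert v (insert w \<sigma>)) j)"
        unfolding h_def using koszul_sign_antisym[of v w \<sigma>, where 'a = "('v, 'k) mpoly"] that fins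
        by (simp only: insert_commute[of w v \<sigma>] mult.commute[of "var w" "var v"]) simp
      thus ?thesis by (simp add: h_def)
    qed
    let ?P = "{(v, w). v \<in> V - \<sigma> \<and> w \<in> V - \<sigma> \<and> rk v < rk w}"
    let ?Q = "{(v, w). v \<in> V - \<sigma> \<and> w \<in> V - \<sigma> \<and> rk w < rk v}"
    have fin_PQ: "finite ?P" "finite ?Q"
      by (rule finite_subset[of _ "V \<times> V"]; use fin in auto)+
    have "koszul_bd (koszul_bd f) \<sigma> j = (\<Sum>v\<in>V - \<sigma>. \<Sum>w\<in>V - insert v \<sigma>. h v w)"
      unfolding koszul_bd_def h_def by (simp add: sum_distrib_left mult_ac)
    also have "\<dots> = (\<Sum>(v, w)\<in>(SIGMA v:V - \<sigma>. V - insert v \<sigma>). h v w)"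
      using fin by (subst sum.Sigma) auto
    also have "(SIGMA v:V - \<sigma>. V - insert v \<sigma>) = ?P \<union> ?Q"
      using inj by (auto simp: inj_on_def) (metis linorder_neqE_nat)+
    also have "(\<Sum>(v, w)\<in>?P \<union> ?Q. h v w) = (\<Sum>(v, w)\<in>?P. h v w) + (\<Sum>(v, w)\<in>?Q. h v w)"
      by (rule sum.union_disjoint) (use fin_PQ in auto)
    also have "(\<Sum>(v, w)\<in>?Q. h v w) = (\<Sum>(v, w)\<in>?P. h w v)"
      by (rule sum.reindex_bij_witness[where i = "\<lambda>(a, b). (b, a)" and j = "\<lambda>(a, b). (b, a)"]) auto
    also have "(\<Sum>(v, w)\<in>?P. h v w) + (\<Sum>(v, w)\<in>?P. h w v) = (\<Sum>x\<in>?P. case x of (v, w) \<Rightarrow> h v w + h w v)"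
      by (simp add: sum.distrib[symmetric] case_prod_beta)
    also have "\<dots> = 0"
      by (rule sum.neutral) (auto intro!: h)
    finally show ?thesis by simp
  qed
qed

lemma koszul_bd_diff: "koszul_bd (f - g) = koszul_bd f - koszul_bd g"
  by (intro ext) (simp add: koszul_bd_def sum_subtractf[symmetric] algebra_simps)

section \<open>Graded submodules of free modules\<close>

definition smul :: "('v, 'k::field) mpoly \<Rightarrow> (nat \<Rightarrow> ('v, 'k) mpoly) \<Rightarrow> nat \<Rightarrow> ('v, 'k) mpoly" where
  "smul c u = (\<lambda>j. c * u j)"

definition submod :: "nat \<Rightarrow> (nat \<Rightarrow> ('v, 'k::field) mpoly) set \<Rightarrow> bool" where
  "submod n N \<longleftrightarrow> N \<subseteq> fmod n \<and> 0 \<in> N \<and> (\<forall>u\<in>N. \<forall>w\<in>N. u + w \<in> N) \<and>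
     (\<forall>c\<in>poly_carrier V. \<forall>u\<in>N. smul c u \<in> N)"

lemma sum_fun_apply: "(\<Sum>x\<in>A. F x) j = (\<Sum>x\<in>A. F x j)" for F :: "'x \<Rightarrow> 'y \<Rightarrow> 'z::comm_monoid_add"
  by (induction A rule: infinite_finite_induct) auto

lemma submodD:
  assumes "submod n N"
  shows "u \<in> N \<Longrightarrow> u \<in> fmod n" "0 \<in> N" "u \<in> N \<Longrightarrow> w \<in> N \<Longrightarrow> u + w \<in> N"
    "c \<in> poly_carrier V \<Longrightarrow> u \<in> N \<Longrightarrow> smul c u \<in> N"
  using assms unfolding submod_def by blast+

lemma submod_sum:
  assumes "submod n N" "\<And>x. x \<in> A \<Longrightarrow> F x \<in> N"
  shows "(\<Sum>x\<in>A. F x) \<in> N"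
  using assms(2) by (induction A rule: infinite_finite_induct) (auto intro: submodD[OF assms(1)])

lemma submod_fmod: "submod n (fmod n)"
  by (auto simp: submod_def fmod_def smul_def intro: poly_carrier_intros)

section \<open>Homogeneous matrices as degree-preserving maps\<close>

definition linmap :: "nat \<Rightarrow> nat \<Rightarrow> (nat \<Rightarrow> nat \<Rightarrow> ('v, 'k::field) mpoly) \<Rightarrow> (nat \<Rightarrow> ('v, 'k) mpoly) \<Rightarrow> nat \<Rightarrow> ('v, 'k) mpoly"
  where "linmap m n A u = (\<lambda>i. if i < m then \<Sum>j<n. A i j * u j else 0)"

definition hom_mat :: "nat list \<Rightarrow> nat list \<Rightarrow> (nat \<Rightarrow> nat \<Rightarrow> ('v, 'k::field) mpoly) \<Rightarrow> bool" where
  "hom_mat t s A \<longleftrightarrow> (\<forall>i<length t. \<forall>j<length s. A i j \<in> poly_carrier V \<and>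
     (\<forall>m\<in>Poly_Mapping.keys (A i j). mon_degree m + t ! i = s ! j))"

definition hcomp :: "nat list \<Rightarrow> nat \<Rightarrow> (nat \<Rightarrow> ('v, 'k::field) mpoly) \<Rightarrow> nat \<Rightarrow> ('v, 'k) mpoly" where
  "hcomp t d u = (\<lambda>j. if j < length t then poly_filter (\<lambda>m. mon_degree m + t ! j = d) (u j) else 0)"

lemma linmap_add: "linmap m n A (u + w) = linmap m n A u + linmap m n A w"
  by (auto simp: linmap_def fun_eq_iff distrib_left sum.distrib)

lemma linmap_diff: "linmap m n A (u - w) = linmap m n A u - linmap m n A w"
  by (auto simp: linmap_def fun_eq_iff algebra_simps sum_subtractf)

lemma linmap_smul: "linmap m n A (smul c u) = smul c (linmap m n A u)"
  by (auto simp: linmap_def fun_eq_iff smul_def sum_distrib_left mult_ac)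

lemma linmap_zero [simp]: "linmap m n A 0 = 0"
  by (auto simp: linmap_def fun_eq_iff)

lemma linmap_sum: "linmap m n A (\<Sum>x\<in>X. F x) = (\<Sum>x\<in>X. linmap m n A (F x))"
  by (induction X rule: infinite_finite_induct)
     (simp_all only: sum.infinite sum.empty sum.insert linmap_zero linmap_add not_False_eq_True)

lemma linmap_fmod:
  assumes "hom_mat t s A" "u \<in> fmod (length s)"
  shows "linmap (length t) (length s) A u \<in> fmod (length t)"
  using assms by (auto simp: linmap_def fmod_def hom_mat_def intro!: poly_carrier_intros)

lemma submod_image:
  fixes A :: "nat \<Rightarrow> nat \<Rightarrow> ('v, 'k::field) mpoly"
  assumes "hom_mat t s A"
  shows "submod (length t) (linmap (length t) (length s) A ` fmod (length s))"
proof -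
  note F = submodD[OF submod_fmod[of "length s"]]
  show ?thesis
    unfolding submod_def
  proof (intro conjI ballI)
    show "0 \<in> linmap (length t) (length s) A ` fmod (length s)"
      using F(2) by (metis image_eqI linmap_zero)
  next
    show "linmap (length t) (length s) A ` fmod (length s) \<subseteq> fmod (length t)"
      using assms by (auto intro: linmap_fmod)
  next
    fix u w :: "nat \<Rightarrow> ('v, 'k) mpoly" assume "u \<in> linmap (length t) (length s) A ` fmod (length s)"
      "w \<in> linmap (length t) (length s) A ` fmod (length s)"
    thus "u + w \<in> linmap (length t) (length s) A ` fmod (length s)"
      by (elim imageE) (simp only: linmap_add[symmetric] F(3) imageI)
  next
    fix c :: "('v, 'k) mpoly" and u :: "nat \<Rightarrow> ('v, 'k) mpoly" assume "c \<in> poly_carrier V" "u \<in> linmap (length t) (length s) A ` fmod (length s)"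
    thus "smul c u \<in> linmap (length t) (length s) A ` fmod (length s)"
      by (elim imageE) (simp only: linmap_smul[symmetric] F(4) imageI)
  qed
qed

lemma submod_kernel:
  "submod n {u \<in> fmod n. linmap m n A u = 0}"
  using submod_fmod[of n] unfolding submod_def by (auto simp: linmap_add linmap_smul) (simp add: smul_def fun_eq_iff)

lemma hcomp_hom_elem: "hom_elem t d (hcomp t d u)"
  by (auto simp: hom_elem_def hcomp_def keys_poly_filter)

lemma hcomp_zero [simp]: "hcomp t d 0 = 0"
  by (auto simp: hcomp_def fun_eq_iff intro!: poly_mapping_eqI simp: lookup_poly_filter)

lemma hcomp_fmod: "u \<in> fmod (length t) \<Longrightarrow> hcomp t d u \<in> fmod (length t)"
  by (auto simp: fmod_def hcomp_def intro: poly_filter_carrier)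

lemma hcomp_id:
  assumes "u \<in> fmod (length t)" "hom_elem t d u"
  shows "hcomp t d u = u"
proof (intro ext poly_mapping_eqI)
  fix j m
  show "Poly_Mapping.lookup (hcomp t d u j) m = Poly_Mapping.lookup (u j) m"
  proof (cases "j < length t")
    case True
    hence "Poly_Mapping.lookup (u j) m \<noteq> 0 \<Longrightarrow> mon_degree m + t ! j = d"
      using assms(2) by (auto simp: hom_elem_def in_keys_iff)
    thus ?thesis using True by (auto simp: hcomp_def lookup_poly_filter)
  qed (use assms(1) in \<open>simp add: hcomp_def fmod_def\<close>)
qed

text \<open>The degree of an entry is the difference of the two shifts attached to its column and
  row, so the map preserves degrees. Homogeneous preimages and homogeneous relations are obtained
  from this.\<close>

lemma linmap_hcomp:
  assumes "hom_mat t s A"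
  shows "linmap (length t) (length s) A (hcomp s d u) = hcomp t d (linmap (length t) (length s) A u)"
proof
  fix i
  have "poly_filter (\<lambda>m. mon_degree m + t ! i = d) (A i j * u j)
      = A i j * poly_filter (\<lambda>m. mon_degree m + s ! j = d) (u j)"
    if "i < length t" "j < length s" for j
  proof (rule poly_filter_mult)
    fix a b assume "a \<in> Poly_Mapping.keys (A i j)"
    hence "mon_degree a + t ! i = s ! j" using assms that by (simp add: hom_mat_def)
    thus "mon_degree (a + b) + t ! i = d \<longleftrightarrow> mon_degree b + s ! j = d"
      by (auto simp: mon_degree_add)
  qed
  thus "linmap (length t) (length s) A (hcomp s d u) i = hcomp t d (linmap (length t) (length s) A u) i"
    by (simp add: linmap_def hcomp_def poly_filter_sum)
qed

lemma linmap_hom_elem: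
  assumes "hom_mat t s A" "u \<in> fmod (length s)" "hom_elem s d u"
  shows "hom_elem t d (linmap (length t) (length s) A u)"
  using linmap_hcomp[OF assms(1), of d u] hcomp_id[OF assms(2,3)] hcomp_hom_elem by metis

lemma sum_hcomp:
  assumes "u \<in> fmod (length t)"
  obtains D where "finite D" "u = (\<Sum>d\<in>D. hcomp t d u)"
proof
  let ?D = "\<Union>j<length t. (\<lambda>m. mon_degree m + t ! j) ` Poly_Mapping.keys (u j)"
  show fin_D: "finite ?D" by auto
  show "u = (\<Sum>d\<in>?D. hcomp t d u)"
  proof (intro ext poly_mapping_eqI)
    fix j m
    show "Poly_Mapping.lookup (u j) m = Poly_Mapping.lookup ((\<Sum>d\<in>?D. hcomp t d u) j) m"
    proof (cases "j < length t")
      case False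
      thus ?thesis using assms by (simp add: sum_fun_apply hcomp_def fmod_def)
    next
      case True
      have "Poly_Mapping.lookup ((\<Sum>d\<in>?D. hcomp t d u) j) m
          = (\<Sum>d\<in>?D. if mon_degree m + t ! j = d then Poly_Mapping.lookup (u j) m else 0)"
        using True by (simp add: sum_fun_apply hcomp_def lookup_sum lookup_poly_filter)
      also have "\<dots> = (if mon_degree m + t ! j \<in> ?D then Poly_Mapping.lookup (u j) m else 0)"
        using fin_D by (rule sum.delta')
      also have "\<dots> = Poly_Mapping.lookup (u j) m"
      proof (cases "Poly_Mapping.lookup (u j) m = 0")
        case False
        hence "mon_degree m + t ! j \<in> ?D"
          using True by (intro UN_I[of j] imageI) (auto simp: in_keys_iff)
        thus ?thesis by (rule if_P)
      qed simp
      finally show ?thesis by simp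
    qed
  qed
qed

section \<open>Koszul homology of kernels, and degrees of generators\<close>

lemma koszul_bd_linmap:
  "koszul_bd (\<lambda>\<sigma>. linmap m n A (f \<sigma>)) = (\<lambda>\<sigma>. linmap m n A (koszul_bd f \<sigma>))"
proof (intro ext)
  fix \<sigma> i
  show "koszul_bd (\<lambda>\<sigma>. linmap m n A (f \<sigma>)) \<sigma> i = linmap m n A (koszul_bd f \<sigma>) i"
    by (simp add: koszul_bd_def linmap_def sum_distrib_left mult_ac) (subst sum.swap, simp)
qed

lemma koszul_bd_chain:
  assumes "koszul_chain (fmod (length t)) t e (Suc p) f"
  shows "koszul_chain (fmod (length t)) t (Suc e) p (koszul_bd f)"
proof (rule koszul_chainI)
  fix \<sigma> assume s: "\<sigma> \<subseteq> V" "card \<sigma> = p"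
  have "finite \<sigma>" using s fin finite_subset by blast
  hence i: "insert v \<sigma> \<subseteq> V" "card (insert v \<sigma>) = Suc p" if "v \<in> V - \<sigma>" for v
    using that s by auto
  have "koszul_bd f \<sigma> \<in> fmod (length t)"
    using koszul_chainD(1)[OF assms i]
    by (auto simp: koszul_bd_def fmod_def intro!: poly_carrier_intros sum.neutral)
  moreover have "hom_elem t (Suc e) (koszul_bd f \<sigma>)"
    unfolding hom_elem_def
  proof (intro allI impI ballI)
    fix j m assume j: "j < length t" and "m \<in> Poly_Mapping.keys (koszul_bd f \<sigma> j)"
    then obtain v where v: "v \<in> V - \<sigma>" "m \<in> Poly_Mapping.keys (koszul_sign rk v \<sigma> * (var v * f (insert v \<sigma>) j))"
      unfolding koszul_bd_def by (elim in_keys_sumE)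
    hence "Poly_Mapping.lookup (var v * f (insert v \<sigma>) j) m \<noteq> 0"
      by (auto simp: in_keys_iff)
    hence m: "Poly_Mapping.lookup m v > 0"
      and k: "m - Poly_Mapping.single v 1 \<in> Poly_Mapping.keys (f (insert v \<sigma>) j)"
      by (auto simp: in_keys_iff lookup_var_mult split: if_splits)
    have "mon_degree (m - Poly_Mapping.single v 1) + t ! j = e"
      using koszul_chainD(2)[OF assms i[OF v(1)]] j k by (simp add: hom_elem_def)
    moreover have "mon_degree m = mon_degree (m - Poly_Mapping.single v 1) + 1"
      by (subst mon_minus_single_add[OF m, symmetric], subst mon_degree_add) simp
    ultimately show "mon_degree m + t ! j = Suc e" by simp
  qed
  ultimately show "koszul_bd f \<sigma> \<in> fmod (length t) \<and> hom_elem t (Suc e) (koszul_bd f \<sigma>)" ..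
next
  fix \<sigma> assume s: "\<not> (\<sigma> \<subseteq> V \<and> card \<sigma> = p)"
  have "f (insert v \<sigma>) = 0" if "v \<in> V - \<sigma>" for v
  proof (rule koszul_chainD(3)[OF assms], rule notI)
    assume a: "insert v \<sigma> \<subseteq> V \<and> card (insert v \<sigma>) = Suc p"
    hence "\<sigma> \<subseteq> V" by blast
    moreover have "card (insert v \<sigma>) = Suc (card \<sigma>)"
      using that finite_subset[OF \<open>\<sigma> \<subseteq> V\<close> fin] by simp
    ultimately show False using a s by linarith
  qed
  thus "koszul_bd f \<sigma> = 0" by (simp add: koszul_bd_def fun_eq_iff)
qed

lemma koszul_chain_diff:
  assumes "koszul_chain (fmod (length t)) t e p f" "koszul_chain (fmod (length t)) t e p g"
  shows "koszul_chain (fmod (length t)) t e p (f - g)"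
proof (rule koszul_chainI)
  fix \<sigma> assume s: "\<sigma> \<subseteq> V" "card \<sigma> = p"
  note D = koszul_chainD(1,2)[OF assms(1) s] koszul_chainD(1,2)[OF assms(2) s]
  have "f \<sigma> - g \<sigma> = f \<sigma> + smul (- 1) (g \<sigma>)" by (auto simp: smul_def fun_eq_iff)
  moreover have "f \<sigma> + smul (- 1) (g \<sigma>) \<in> fmod (length t)"
    using D by (intro submodD(3,4)[OF submod_fmod] poly_carrier_uminus poly_carrier_1)
  ultimately have "f \<sigma> - g \<sigma> \<in> fmod (length t)" by (simp only:)
  moreover have "hom_elem t e (f \<sigma> - g \<sigma>)"
    using D by (fastforce simp: hom_elem_def in_keys_iff lookup_minus)
  ultimately show "(f - g) \<sigma> \<in> fmod (length t) \<and> hom_elem t e ((f - g) \<sigma>)" by simp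
next
  fix \<sigma> assume "\<not> (\<sigma> \<subseteq> V \<and> card \<sigma> = p)"
  thus "(f - g) \<sigma> = 0" using koszul_chainD(3)[OF assms(1)] koszul_chainD(3)[OF assms(2)] by simp
qed

text \<open>The long exact sequence of kernel, free module and image, chased by hand. A cycle
  \<open>f\<close> of the kernel is filled by \<open>w\<close> in the free module; the image of
  \<open>w\<close> is a cycle one homological degree higher and is filled by \<open>u\<close>; with
  a lift \<open>x\<close> of \<open>u\<close>, the corrected filling \<open>w - koszul_bd x\<close>
  lies in the kernel.\<close>

lemma reg_le_kernel:
  fixes A :: "nat \<Rightarrow> nat \<Rightarrow> ('v, 'k::field) mpoly"
  assumes A: "hom_mat t s A"
    and reg: "reg_le (linmap (length t) (length s) A ` fmod (length s)) t r"
    and shifts: "\<And>j. j < length s \<Longrightarrow> s ! j \<le> r"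
  shows "reg_le {u \<in> fmod (length s). linmap (length t) (length s) A u = 0} s (Suc r)"
  unfolding reg_le_def
proof (intro allI impI)
  let ?L = "linmap (length t) (length s) A"
  let ?F = "fmod (length s) :: (nat \<Rightarrow> ('v, 'k) mpoly) set"
  let ?Z = "{u \<in> ?F. ?L u = 0}"
  fix p e and f :: "'v set \<Rightarrow> nat \<Rightarrow> ('v, 'k) mpoly"
  assume "Suc r \<le> e" and f: "koszul_chain ?Z s (Suc e) p f" and cyc: "koszul_bd f = 0"
  \<comment> \<open>The source of the shift by one: the image of \<open>w\<close> has coefficients
    of degree \<open>e\<close>, and \<open>reg\<close> can fill it only if \<open>e\<close> is the
    successor of a degree that is at least \<open>r\<close>.\<close>
  then obtain e' where e: "e = Suc e'" "r \<le> e'" by (cases e) auto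
  have fF: "koszul_chain ?F s (Suc e) p f"
    by (rule koszul_chainI) (use koszul_chainD[OF f] in auto)
  have Lf: "?L (f \<sigma>) = 0" for \<sigma>
    using koszul_chainD(1)[OF f, of \<sigma>] koszul_chainD(3)[OF f, of \<sigma>] by (cases "\<sigma> \<subseteq> V \<and> card \<sigma> = p") auto
  have "r \<le> e" using e by simp
  then obtain w where w: "koszul_chain ?F s e (Suc p) w" "koszul_bd w = f"
    using reg_leD[OF reg_le_fmod[of s, OF shifts] _ fF cyc] by blast
  have Lw: "koszul_chain (?L ` ?F) t (Suc e') (Suc p) (\<lambda>\<sigma>. ?L (w \<sigma>))"
    by (rule koszul_chainI)
       (use koszul_chainD[OF w(1)] linmap_hom_elem[OF A] e in auto)
  have "koszul_bd (\<lambda>\<sigma>. ?L (w \<sigma>)) = 0"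
    by (simp add: koszul_bd_linmap w(2) Lf fun_eq_iff)
  then obtain u where u: "koszul_chain (?L ` ?F) t e' (Suc (Suc p)) u" "koszul_bd u = (\<lambda>\<sigma>. ?L (w \<sigma>))"
    using reg_leD[OF reg e(2) Lw] by blast
  have "\<forall>\<sigma>. \<exists>x. ?L x = u \<sigma> \<and> (if \<sigma> \<subseteq> V \<and> card \<sigma> = Suc (Suc p) then x \<in> ?F \<and> hom_elem s e' x else x = 0)"
  proof
    fix \<sigma>
    show "\<exists>x. ?L x = u \<sigma> \<and> (if \<sigma> \<subseteq> V \<and> card \<sigma> = Suc (Suc p) then x \<in> ?F \<and> hom_elem s e' x else x = 0)"
    proof (cases "\<sigma> \<subseteq> V \<and> card \<sigma> = Suc (Suc p)")
      case True
      then obtain x where x: "x \<in> ?F" "u \<sigma> = ?L x" and h: "hom_elem t e' (u \<sigma>)"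
        using koszul_chainD(1,2)[OF u(1), of \<sigma>] by blast
      \<comment> \<open>A preimage need not be homogeneous, but its component of degree
        \<open>e'\<close> is, and it has the same image because \<open>u \<sigma>\<close> is
        homogeneous of that degree.\<close>
      have "?L (hcomp s e' x) = hcomp t e' (u \<sigma>)"
        by (simp only: linmap_hcomp[OF A] x(2))
      also have "\<dots> = u \<sigma>"
        by (rule hcomp_id) (use h linmap_fmod[OF A x(1)] x(2) in auto)
      finally show ?thesis
        using True hcomp_fmod[OF x(1)] hcomp_hom_elem[of s e' x] by (intro exI[of _ "hcomp s e' x"]) simp
    next
      case False
      have "u \<sigma> = 0" by (rule koszul_chainD(3)[OF u(1) False])
      thus ?thesis by (intro exI[of _ 0]) (simp only: linmap_zero if_not_P[OF False] simp_thms)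
    qed
  qed
  then obtain x where x': "\<forall>\<sigma>. ?L (x \<sigma>) = u \<sigma> \<and>
      (if \<sigma> \<subseteq> V \<and> card \<sigma> = Suc (Suc p) then x \<sigma> \<in> ?F \<and> hom_elem s e' (x \<sigma>) else x \<sigma> = 0)"
    by (rule exE[OF choice])
  have x: "?L (x \<sigma>) = u \<sigma>"
    "if \<sigma> \<subseteq> V \<and> card \<sigma> = Suc (Suc p) then x \<sigma> \<in> ?F \<and> hom_elem s e' (x \<sigma>) else x \<sigma> = 0" for \<sigma>
    using x' by blast+
  have xF: "koszul_chain ?F s e' (Suc (Suc p)) x"
    unfolding koszul_chain_def by (intro allI x(2))
  have bx: "koszul_chain ?F s e (Suc p) (koszul_bd x)"
    using koszul_bd_chain[OF xF] e by simp
  let ?g = "w - koszul_bd x"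
  have g: "koszul_chain ?F s e (Suc p) ?g"
    by (rule koszul_chain_diff[OF w(1) bx])
  have "?L (?g \<sigma>) = 0" for \<sigma>
  proof -
    have "?L (?g \<sigma>) = ?L (w \<sigma>) - koszul_bd (\<lambda>\<sigma>. ?L (x \<sigma>)) \<sigma>"
      by (simp only: minus_apply linmap_diff koszul_bd_linmap)
    also have "koszul_bd (\<lambda>\<sigma>. ?L (x \<sigma>)) \<sigma> = ?L (w \<sigma>)" by (simp only: x(1) u(2))
    finally show ?thesis by (simp only: diff_self)
  qed
  hence "koszul_chain ?Z s e (Suc p) ?g"
    using koszul_chainD[OF g] by (intro koszul_chainI) auto
  moreover have "koszul_bd (koszul_bd x) = 0"
    by (rule koszul_bd_bd) (use koszul_chainD(3)[OF xF] in auto)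
  hence "koszul_bd ?g = f" by (simp add: koszul_bd_diff w(2))
  ultimately show "\<exists>g. koszul_chain ?Z s e (Suc p) g \<and> koszul_bd g = f" by blast
qed

text \<open>The case \<open>p = 0\<close> of \<open>reg_le\<close>: a chain on the empty face is an
  element of \<open>M\<close>, it is always a cycle, and a filling writes it as a combination of
  variables.\<close>

lemma reg_le_generated:
  assumes "reg_le M t r" "r \<le> e" "u \<in> M" "hom_elem t (Suc e) u"
  shows "\<exists>w. (\<forall>v\<in>V. w v \<in> M \<and> hom_elem t e (w v)) \<and> u = (\<Sum>v\<in>V. smul (var v) (w v))"
proof -
  define f where "f \<sigma> = (if \<sigma> = {} then u else 0)" for \<sigma> :: "'v set"
  have "koszul_chain M t (Suc e) 0 f"
  proof (rule koszul_chainI)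
    fix \<sigma> assume "\<sigma> \<subseteq> V" "card \<sigma> = 0"
    hence "\<sigma> = {}" using fin finite_subset by fastforce
    thus "f \<sigma> \<in> M \<and> hom_elem t (Suc e) (f \<sigma>)" using assms by (simp add: f_def)
  qed (auto simp: f_def)
  moreover have "koszul_bd f = 0" by (auto simp: koszul_bd_def f_def fun_eq_iff)
  ultimately obtain g where g: "koszul_chain M t e (Suc 0) g" "koszul_bd g = f"
    using reg_leD[OF assms(1,2)] by blast
  have "u = koszul_bd g {}" by (simp add: g(2) f_def)
  also have "\<dots> = (\<Sum>v\<in>V. smul (var v) (g {v}))"
    by (auto simp: koszul_bd_def fun_eq_iff sum_fun_apply smul_def)
  finally have eq: "u = (\<Sum>v\<in>V. smul (var v) (g {v}))" .
  have mem: "g {v} \<in> M \<and> hom_elem t e (g {v})" if "v \<in> V" for v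
    using koszul_chainD(1,2)[OF g(1), of "{v}"] that by simp
  show ?thesis
    by (rule exI[of _ "\<lambda>v. g {v}"], rule conjI, rule ballI, erule mem, rule eq)
qed

definition basis_elem :: "nat \<Rightarrow> nat \<Rightarrow> ('v, 'k::field) mpoly" where
  "basis_elem q = (\<lambda>j. if j = q then 1 else 0)"

lemma basis_elem_fmod: "q < n \<Longrightarrow> basis_elem q \<in> fmod n"
  by (auto simp: fmod_def basis_elem_def)

lemma linmap_basis_elem:
  "q < n \<Longrightarrow> linmap m n A (basis_elem q) = (\<lambda>i. if i < m then A i q else 0)"
  by (auto simp: linmap_def basis_elem_def fun_eq_iff if_distrib cong: if_cong)

text \<open>A graded Nakayama argument. A generator of degree above \<open>r\<close> would be a
  combination of variables times elements of the image; lifting these gives a relation whose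
  coefficient at \<open>q\<close> has constant term 1, against \<open>minimal\<close>.\<close>

lemma minimal_shift_le:
  assumes A: "hom_mat t s A"
    and reg: "reg_le (linmap (length t) (length s) A ` fmod (length s)) t r"
    and minimal: "\<And>u q. u \<in> fmod (length s) \<Longrightarrow> linmap (length t) (length s) A u = 0 \<Longrightarrow>
      Poly_Mapping.lookup (u q) 0 = 0"
    and q: "q < length s"
  shows "s ! q \<le> r"
proof (rule ccontr)
  let ?L = "linmap (length t) (length s) A"
  assume "\<not> s ! q \<le> r"
  then obtain e where e: "s ! q = Suc e" "r \<le> e" by (cases "s ! q") auto
  let ?u = "?L (basis_elem q)"
  have "hom_elem s (s ! q) (basis_elem q)"
    by (auto simp: hom_elem_def basis_elem_def)
  hence "hom_elem t (Suc e) ?u"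
    using linmap_hom_elem[OF A basis_elem_fmod[OF q]] e(1) by metis
  moreover have "?u \<in> ?L ` fmod (length s)" using basis_elem_fmod[OF q] by blast
  ultimately obtain w where w: "\<forall>v\<in>V. w v \<in> ?L ` fmod (length s) \<and> hom_elem t e (w v)"
      "?u = (\<Sum>v\<in>V. smul (var v) (w v))"
    using reg_le_generated[OF reg e(2)] by blast
  have "\<forall>v\<in>V. \<exists>x. x \<in> fmod (length s) \<and> w v = ?L x"
    using w(1) by blast
  then obtain x where "\<forall>v\<in>V. x v \<in> fmod (length s) \<and> w v = ?L (x v)"
    by (rule exE[OF bchoice])
  hence x: "\<And>v. v \<in> V \<Longrightarrow> x v \<in> fmod (length s) \<and> w v = ?L (x v)" by blast
  let ?y = "\<Sum>v\<in>V. smul (var v) (x v)"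
  have yF: "?y \<in> fmod (length s)"
    by (intro submod_sum[OF submod_fmod] submodD(4)[OF submod_fmod] poly_carrier_var) (use x in auto)
  let ?z = "basis_elem q + smul (- 1) ?y"
  have zF: "?z \<in> fmod (length s)"
    using yF basis_elem_fmod[OF q] by (intro submodD(3,4)[OF submod_fmod] poly_carrier_uminus) auto
  have "?L ?y = ?u"
    unfolding linmap_sum w(2) by (rule sum.cong) (use x in \<open>auto simp: linmap_smul\<close>)
  hence "?L ?z = ?u + smul (- 1) ?u" by (simp only: linmap_add linmap_smul)
  also have "\<dots> = 0" by (simp add: smul_def fun_eq_iff)
  finally have "?L ?z = 0" .
  hence "Poly_Mapping.lookup (?z q) 0 = 0" by (rule minimal[OF zF])
  moreover have "Poly_Mapping.lookup (?y q) 0 = 0"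
    by (simp add: sum_fun_apply lookup_sum smul_def lookup_var_mult)
  moreover have "?z q = 1 + - 1 * ?y q"
    by (simp only: plus_fun_apply basis_elem_def smul_def refl if_True)
  ultimately have "Poly_Mapping.lookup (1 + - 1 * ?y q) 0 = 0" "Poly_Mapping.lookup (?y q) 0 = 0"
    by (simp_all only:)
  thus False by (simp add: lookup_minus)
qed

end


section \<open>Minimal generators\<close>

lemma lookup_le_mon_degree: "Poly_Mapping.lookup m v \<le> mon_degree m"
  by (cases "v \<in> Poly_Mapping.keys m") (auto simp: mon_degree_def in_keys_iff intro: member_le_sum)

lemma finite_mon_degree_le:
  assumes "finite V"
  shows "finite {m :: 'v mon. Poly_Mapping.keys m \<subseteq> V \<and> mon_degree m \<le> e}"
proof -
  let ?M = "{m :: 'v mon. Poly_Mapping.keys m \<subseteq> V \<and> mon_degree m \<le> e}"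
  have sub: "Poly_Mapping.lookup ` ?M \<subseteq> {f :: 'v \<Rightarrow> nat. \<forall>v. (v \<in> V \<longrightarrow> f v \<in> {..e}) \<and> (v \<notin> V \<longrightarrow> f v = 0)}"
  proof (intro image_subsetI CollectI allI conjI impI)
    fix m :: "'v mon" and v
    assume m: "m \<in> ?M"
    show "Poly_Mapping.lookup m v \<in> {..e}"
      using m lookup_le_mon_degree[of m v] by simp
    assume "v \<notin> V"
    hence "v \<notin> Poly_Mapping.keys m" using m by blast
    thus "Poly_Mapping.lookup m v = 0" by (simp add: in_keys_iff)
  qed
  have "finite {f :: 'v \<Rightarrow> nat. \<forall>v. (v \<in> V \<longrightarrow> f v \<in> {..e}) \<and> (v \<notin> V \<longrightarrow> f v = 0)}"
    by (rule finite_set_of_finite_funs[OF assms finite_atMost[of e], of 0])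
  hence finite_lookup: "finite (Poly_Mapping.lookup ` ?M)"
    by (rule finite_subset[OF sub])
  have "inj_on Poly_Mapping.lookup ?M"
    by (rule inj_onI) (simp only: poly_mapping_eq_iff)
  thus ?thesis by (rule finite_imageD[OF finite_lookup])
qed

lemma sum_single_lookup: "(\<Sum>m\<in>Poly_Mapping.keys p. Poly_Mapping.single m (Poly_Mapping.lookup p m)) = p"
  by (intro poly_mapping_eqI) (auto simp: lookup_sum lookup_single when_def in_keys_iff)

context ranked_vars
begin

text \<open>One graded component of a free module lies in a finite-dimensional vector space over the
  coefficient field. Generation is phrased through all submodules that contain \<open>B\<close>, so
  that vector space spans and module spans need not be compared.\<close>

lemma hom_part_finitely_generated:
  fixes N :: "(nat \<Rightarrow> ('v, 'k::field) mpoly) set"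
  assumes N: "\<And>u. u \<in> N \<Longrightarrow> u \<in> fmod (length t)" "\<And>u. u \<in> N \<Longrightarrow> hom_elem t e u"
  shows "\<exists>B. finite B \<and> B \<subseteq> N \<and> (\<forall>S. submod (length t) S \<longrightarrow> B \<subseteq> S \<longrightarrow> N \<subseteq> S)"
proof -
  \<comment> \<open>Scalars are the constant polynomials; every submodule is therefore a
    subspace.\<close>
  interpret vs: vector_space "\<lambda>(c::'k) (u :: nat \<Rightarrow> ('v, 'k) mpoly). smul (Poly_Mapping.single 0 c) u"
    by unfold_locales (simp_all add: smul_def fun_eq_iff algebra_simps single_add mult_single)
  obtain B where B: "B \<subseteq> N" "vs.independent B" "N \<subseteq> vs.span B"
    using vs.maximal_independent_subset by blast
  define bm where "bm x = (\<lambda>i. if i = fst x then Poly_Mapping.single (snd x) (1::'k) else 0)" for x :: "nat \<times> 'v mon"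
  let ?T = "bm ` ({..<length t} \<times> {m. Poly_Mapping.keys m \<subseteq> V \<and> mon_degree m \<le> e})"
  have fin_T: "finite ?T" using finite_mon_degree_le[OF fin] by auto
  have "u \<in> vs.span ?T" if u: "u \<in> N" for u
  proof -
    have "u = (\<Sum>j<length t. \<Sum>m\<in>Poly_Mapping.keys (u j).
        smul (Poly_Mapping.single 0 (Poly_Mapping.lookup (u j) m)) (bm (j, m)))" (is "_ = ?R")
    proof
      fix i
      have "?R i = (\<Sum>j<length t. if i = j then (\<Sum>m\<in>Poly_Mapping.keys (u j).
          Poly_Mapping.single m (Poly_Mapping.lookup (u j) m)) else 0)"
        unfolding sum_fun_apply
        by (rule sum.cong) (auto simp: smul_def bm_def mult_single)
      also have "\<dots> = (\<Sum>j<length t. if i = j then u j else 0)"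
        by (simp only: sum_single_lookup)
      also have "\<dots> = u i" using N(1)[OF u] by (auto simp: fmod_def)
      finally show "u i = ?R i" by simp
    qed
    also have "\<dots> \<in> vs.span ?T"
    proof (intro vs.span_sum vs.span_scale vs.span_base imageI SigmaI)
      fix j m assume j: "j \<in> {..<length t}" and m: "m \<in> Poly_Mapping.keys (u j)"
      have "mon_degree m + t ! j = e" using N(2)[OF u] j m by (simp add: hom_elem_def)
      moreover have "Poly_Mapping.keys m \<subseteq> V"
        using N(1)[OF u] m by (auto simp: fmod_def dest: poly_carrierD)
      ultimately show "m \<in> {m. Poly_Mapping.keys m \<subseteq> V \<and> mon_degree m \<le> e}" by simp
    qed
    finally show ?thesis .
  qed
  hence "B \<subseteq> vs.span ?T" using B(1) by blast
  hence "finite B" using vs.independent_span_bound[OF fin_T B(2)] by blast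
  moreover have "N \<subseteq> S" if S: "submod (length t) S" "B \<subseteq> S" for S
  proof -
    have "vs.subspace S"
      unfolding vs.subspace_def
      by (intro conjI ballI allI submodD(2-4)[OF S(1)] poly_carrier_single) auto
    hence "vs.span B \<subseteq> S" by (rule vs.span_minimal[OF S(2)])
    thus ?thesis using B(3) by (rule order_trans[rotated])
  qed
  ultimately show ?thesis using B(1) by (intro exI[of _ B]) simp
qed

text \<open>Minimality is stated on the relations: one with a nonzero constant coefficient would
  make a generator redundant. In this form it is exactly the condition that the next differential
  has no constant terms.\<close>

definition minimal_gens :: "nat list \<Rightarrow> nat list \<Rightarrow> (nat \<Rightarrow> nat \<Rightarrow> ('v, 'k::field) mpoly) \<Rightarrow> bool" where
  "minimal_gens t s A \<longleftrightarrow> hom_mat t s A \<and> (\<forall>u\<in>fmod (length s). linmap (length t) (length s) A u = 0 \<longrightarrow>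
     (\<forall>q. Poly_Mapping.lookup (u q) 0 = 0))"

text \<open>Finite generating sets of the components up to degree \<open>r\<close> suffice: by
  \<open>reg_le_generated\<close>, each higher component consists of combinations of variables times
  the preceding one. Gradedness of \<open>M\<close> then reaches arbitrary elements through their
  components.\<close>

lemma reg_le_finitely_generated:
  fixes M :: "(nat \<Rightarrow> ('v, 'k::field) mpoly) set"
  assumes M: "submod (length t) M" and graded: "\<And>u d. u \<in> M \<Longrightarrow> hcomp t d u \<in> M"
    and reg: "reg_le M t r"
  shows "\<exists>B. finite B \<and> B \<subseteq> M \<and> (\<forall>b\<in>B. \<exists>d. hom_elem t d b) \<and>
    (\<forall>S. submod (length t) S \<longrightarrow> B \<subseteq> S \<longrightarrow> M \<subseteq> S)"
proof -
  define N where "N e = {u \<in> M. hom_elem t e u}" for e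
  have "\<forall>e. \<exists>B. finite B \<and> B \<subseteq> N e \<and> (\<forall>S. submod (length t) S \<longrightarrow> B \<subseteq> S \<longrightarrow> N e \<subseteq> S)"
  proof
    fix e
    show "\<exists>B. finite B \<and> B \<subseteq> N e \<and> (\<forall>S. submod (length t) S \<longrightarrow> B \<subseteq> S \<longrightarrow> N e \<subseteq> S)"
      by (rule hom_part_finitely_generated) (auto simp: N_def intro: submodD(1)[OF M])
  qed
  then obtain B where B: "\<forall>e. finite (B e) \<and> B e \<subseteq> N e \<and> (\<forall>S. submod (length t) S \<longrightarrow> B e \<subseteq> S \<longrightarrow> N e \<subseteq> S)"
    by (rule exE[OF choice])
  let ?B = "\<Union>e\<le>r. B e"
  have gen: "M \<subseteq> S" if S: "submod (length t) S" "?B \<subseteq> S" for S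
  proof
    fix u assume u: "u \<in> M"
    have hom: "N d \<subseteq> S" for d
    proof (induction d)
      case 0
      thus ?case using B S by blast
    next
      case (Suc d)
      show ?case
      proof (cases "Suc d \<le> r")
        case True
        hence "B (Suc d) \<subseteq> S" using S(2) by blast
        thus ?thesis using B S(1) by blast
      next
        case False
        show ?thesis
        proof
          fix x assume "x \<in> N (Suc d)"
          hence x: "x \<in> M" "hom_elem t (Suc d) x" by (auto simp: N_def)
          obtain w where w: "\<forall>v\<in>V. w v \<in> M \<and> hom_elem t d (w v)" "x = (\<Sum>v\<in>V. smul (var v) (w v))"
            using reg_le_generated[OF reg _ x] False by auto
          have "(\<Sum>v\<in>V. smul (var v) (w v)) \<in> S"
            by (intro submod_sum[OF S(1)] submodD(4)[OF S(1)] poly_carrier_var subsetD[OF Suc])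
               (use w(1) in \<open>auto simp: N_def\<close>)
          thus "x \<in> S" by (simp only: w(2))
        qed
      qed
    qed
    obtain D where D: "finite D" "u = (\<Sum>d\<in>D. hcomp t d u)"
      using sum_hcomp[OF submodD(1)[OF M u]] .
    have "hcomp t d u \<in> S" for d
      using hom[of d] graded[OF u, of d] hcomp_hom_elem[of t d u] by (auto simp: N_def)
    hence "(\<Sum>d\<in>D. hcomp t d u) \<in> S"
      by (rule submod_sum[OF S(1)])
    thus "u \<in> S" using D(2) by (simp only: D(2)[symmetric])
  qed
  have "finite ?B" using B by auto
  moreover have "?B \<subseteq> M" "\<forall>b\<in>?B. \<exists>d. hom_elem t d b"
    using B unfolding N_def by blast+
  ultimately show ?thesis
    by (intro exI[of _ ?B] conjI allI impI gen)
qed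

text \<open>A homogeneous generating set of least cardinality works: a relation with a nonzero
  constant coefficient could be solved for one generator, and the remaining ones would still
  generate.\<close>

lemma minimal_gens_exist:
  fixes M :: "(nat \<Rightarrow> ('v, 'k::field) mpoly) set"
  assumes M: "submod (length t) M" and graded: "\<And>u d. u \<in> M \<Longrightarrow> hcomp t d u \<in> M"
    and reg: "reg_le M t r"
  obtains s A where "minimal_gens t s A" "linmap (length t) (length s) A ` fmod (length s) = M"
proof -
  define genset where "genset B \<longleftrightarrow> finite B \<and> B \<subseteq> M \<and> (\<forall>b\<in>B. \<exists>d. hom_elem t d b) \<and>
    (\<forall>S. submod (length t) S \<longrightarrow> B \<subseteq> S \<longrightarrow> M \<subseteq> S)" for B
  obtain B0 where "genset B0"
    using reg_le_finitely_generated[OF M graded reg] unfolding genset_def by blast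
  then obtain B where B: "genset B" and least: "\<And>B'. genset B' \<Longrightarrow> card B \<le> card B'"
    using ex_has_least_nat[of genset B0 card] by blast
  have fin_B: "finite B" and BM: "B \<subseteq> M" and hom_B: "\<And>b. b \<in> B \<Longrightarrow> \<exists>d. hom_elem t d b"
    and gen_B: "\<And>S. submod (length t) S \<Longrightarrow> B \<subseteq> S \<Longrightarrow> M \<subseteq> S"
    using B unfolding genset_def by blast+
  obtain bs where bs: "set bs = B" "distinct bs"
    using finite_distinct_list[OF fin_B] by blast
  define s where "s = map (\<lambda>b. SOME d. hom_elem t d b) bs"
  define A where "A i j = (bs ! j) i" for i j
  have len: "length s = length bs" by (simp add: s_def)
  have bB: "bs ! j \<in> B" if "j < length s" for j using that bs len by auto
  have s_hom: "hom_elem t (s ! j) (bs ! j)" if "j < length s" for j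
    using someI_ex[OF hom_B[OF bB[OF that]]] that len by (simp add: s_def)
  have A: "hom_mat t s A"
    unfolding hom_mat_def
  proof (intro allI impI conjI ballI)
    fix i j assume "i < length t" "j < length s"
    show "A i j \<in> poly_carrier V"
      using submodD(1)[OF M subsetD[OF BM bB[OF \<open>j < length s\<close>]]] by (simp add: A_def fmod_def)
    fix m assume "m \<in> Poly_Mapping.keys (A i j)"
    thus "mon_degree m + t ! i = s ! j"
      using s_hom[OF \<open>j < length s\<close>] \<open>i < length t\<close> by (simp add: A_def hom_elem_def)
  qed
  let ?L = "linmap (length t) (length s) A"
  have L: "?L u = (\<Sum>j<length s. smul (u j) (bs ! j))" for u
  proof
    fix i
    show "?L u i = (\<Sum>j<length s. smul (u j) (bs ! j)) i"
    proof (cases "i < length t")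
      case True
      thus ?thesis by (simp add: linmap_def sum_fun_apply smul_def A_def mult.commute)
    next
      case False
      hence "(bs ! j) i = 0" if "j < length s" for j
        using submodD(1)[OF M subsetD[OF BM bB[OF that]]] by (simp add: fmod_def)
      thus ?thesis using False by (simp add: linmap_def sum_fun_apply smul_def)
    qed
  qed
  have image: "?L ` fmod (length s) = M"
  proof (rule equalityI)
    show "?L ` fmod (length s) \<subseteq> M"
    proof (rule image_subsetI)
      fix u :: "nat \<Rightarrow> ('v, 'k) mpoly" assume "u \<in> fmod (length s)"
      hence "u j \<in> poly_carrier V" for j by (simp add: fmod_def)
      thus "?L u \<in> M"
        unfolding L by (intro submod_sum[OF M] submodD(4)[OF M] subsetD[OF BM] bB) auto
    qed
    show "M \<subseteq> ?L ` fmod (length s)"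
    proof (rule gen_B[OF submod_image[OF A]], rule subsetI)
      fix b assume "b \<in> B"
      then obtain q where q: "q < length s" "b = bs ! q"
        using bs len by (metis in_set_conv_nth)
      have "?L (basis_elem q) = b"
      proof
        fix i
        show "?L (basis_elem q) i = b i"
          using q submodD(1)[OF M subsetD[OF BM bB[OF q(1)]]]
          by (cases "i < length t") (auto simp: linmap_basis_elem A_def fmod_def)
      qed
      thus "b \<in> ?L ` fmod (length s)" using basis_elem_fmod[OF q(1)] by (metis imageI)
    qed
  qed
  have "Poly_Mapping.lookup (u q) 0 = 0" if u: "u \<in> fmod (length s)" and Lu: "?L u = 0" for u q
  proof (rule ccontr)
    define c where "c = Poly_Mapping.lookup (u q) 0"
    assume "Poly_Mapping.lookup (u q) 0 \<noteq> 0"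
    hence c: "c \<noteq> 0" by (simp add: c_def)
    hence q: "q < length s" using u by (auto simp: c_def fmod_def not_less[symmetric])
    define x where "x = hcomp s (s ! q) u"
    have xF: "x \<in> fmod (length s)" unfolding x_def by (rule hcomp_fmod[OF u])
    have "?L x = 0" unfolding x_def by (simp only: linmap_hcomp[OF A] Lu hcomp_zero)
    \<comment> \<open>In the component of degree \<open>s ! q\<close>, the coefficient at
      \<open>q\<close> has degree 0. It is thus the constant \<open>c\<close>, a unit by which the
      relation can be divided.\<close>
    have xq: "x q = Poly_Mapping.single 0 c"
      using q by (intro poly_mapping_eqI)
        (auto simp: x_def hcomp_def lookup_poly_filter c_def lookup_single when_def mon_degree_eq_0_iff)
    let ?J = "{..<length s} - {q}"
    let ?y = "smul (Poly_Mapping.single 0 (- inverse c)) (\<Sum>j\<in>?J. smul (x j) (bs ! j))"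
    have "bs ! q = ?y"
    proof
      fix i
      have "0 = ?L x i" by (simp add: \<open>?L x = 0\<close>)
      also have "\<dots> = x q * (bs ! q) i + (\<Sum>j\<in>?J. x j * (bs ! j) i)"
        unfolding L sum_fun_apply smul_def using q by (subst sum.remove[of _ q]) auto
      finally have "Poly_Mapping.single 0 c * (bs ! q) i = - (\<Sum>j\<in>?J. x j * (bs ! j) i)"
        unfolding xq by (simp add: eq_neg_iff_add_eq_0)
      hence "Poly_Mapping.single 0 (inverse c) * (Poly_Mapping.single 0 c * (bs ! q) i)
          = Poly_Mapping.single 0 (inverse c) * (- (\<Sum>j\<in>?J. x j * (bs ! j) i))" by (simp only:)
      moreover have "Poly_Mapping.single 0 (inverse c) * (Poly_Mapping.single 0 c * (bs ! q) i) = (bs ! q) i"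
        using c by (simp add: mult.assoc[symmetric] mult_single)
      ultimately show "(bs ! q) i = ?y i"
        by (simp add: smul_def sum_fun_apply single_uminus)
    qed
    have "genset (B - {bs ! q})"
      unfolding genset_def
    proof (intro conjI allI impI)
      fix S assume S: "submod (length t) S" "B - {bs ! q} \<subseteq> S"
      have "bs ! j \<in> B - {bs ! q}" if "j \<in> ?J" for j
        using that bB[of j] q bs(2) len nth_eq_iff_index_eq[of bs j q] by auto
      hence "bs ! j \<in> S" if "j \<in> ?J" for j using that S(2) by blast
      moreover have "x j \<in> poly_carrier V" for j using xF by (simp add: fmod_def)
      ultimately have "?y \<in> S"
        by (intro submodD(4)[OF S(1)] submod_sum[OF S(1)] poly_carrier_single) auto
      hence "bs ! q \<in> S" by (simp only: \<open>bs ! q = ?y\<close>[symmetric])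
      hence "B \<subseteq> S" using S(2) by blast
      thus "M \<subseteq> S" by (rule gen_B[OF S(1)])
    qed (use fin_B BM hom_B in auto)
    hence "card B \<le> card (B - {bs ! q})" by (rule least)
    thus False using card_Diff1_less[OF fin_B bB[OF q]] by simp
  qed
  hence "minimal_gens t s A" unfolding minimal_gens_def by (intro conjI ballI impI allI A)
  thus thesis by (rule that[of s A, OF _ image])
qed

text \<open>The induction step along a resolution: minimality bounds the shifts, and this bound is
  what makes \<open>reg_le_kernel\<close> applicable.\<close>

lemma minimal_gens_kernel:
  fixes A :: "nat \<Rightarrow> nat \<Rightarrow> ('v, 'k::field) mpoly"
  assumes A: "minimal_gens t s A"
    and reg: "reg_le (linmap (length t) (length s) A ` fmod (length s)) t r"
  shows "\<And>j. j < length s \<Longrightarrow> s ! j \<le> r"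
    and "reg_le {u \<in> fmod (length s). linmap (length t) (length s) A u = 0} s (Suc r)"
proof -
  have A': "hom_mat t s A" using A by (simp add: minimal_gens_def)
  show *: "s ! j \<le> r" if "j < length s" for j
    by (rule minimal_shift_le[OF A' reg _ that]) (use A in \<open>simp add: minimal_gens_def\<close>)
  show "reg_le {u \<in> fmod (length s). linmap (length t) (length s) A u = 0} s (Suc r)"
    by (rule reg_le_kernel[OF A' reg *])
qed

lemma minimal_gens_step:
  fixes A :: "nat \<Rightarrow> nat \<Rightarrow> ('v, 'k::field) mpoly"
  assumes A: "minimal_gens t s A"
    and reg: "reg_le (linmap (length t) (length s) A ` fmod (length s)) t r"
  obtains s' A' where "minimal_gens s s' A'"
    "linmap (length s) (length s') A' ` fmod (length s')
       = {u \<in> fmod (length s). linmap (length t) (length s) A u = 0}"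
proof -
  have A': "hom_mat t s A" using A by (simp add: minimal_gens_def)
  show thesis
  proof (rule minimal_gens_exist[OF submod_kernel _ minimal_gens_kernel(2)[OF A reg] that])
    fix u d
    assume u: "u \<in> {u \<in> fmod (length s). linmap (length t) (length s) A u = 0}"
    hence "linmap (length t) (length s) A (hcomp s d u) = 0"
      by (simp add: linmap_hcomp[OF A'])
    thus "hcomp s d u \<in> {u \<in> fmod (length s). linmap (length t) (length s) A u = 0}"
      using u hcomp_fmod by blast
  qed
qed

section \<open>Minimal resolutions\<close>

lemma linmap_cong:
  assumes "\<And>i j. i < m \<Longrightarrow> j < n \<Longrightarrow> A i j = A' i j"
  shows "linmap m n A = linmap m n A'"
  using assms by (intro ext) (auto simp: linmap_def)

lemma hom_mat_cong:
  assumes "\<And>i j. i < length t \<Longrightarrow> j < length s \<Longrightarrow> A i j = A' i j"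
  shows "hom_mat t s A \<longleftrightarrow> hom_mat t s A'"
  using assms by (simp add: hom_mat_def)

lemma mult_mat_vec_fun:
  assumes "A \<in> carrier_mat m n"
  shows "A *\<^sub>v vec n u = vec m (linmap m n (\<lambda>p q. A $$ (p, q)) u)"
  using assms by (intro eq_vecI) (auto simp: linmap_def scalar_prod_def lessThan_atLeast0)

lemma free_module_eq: "free_module V n = vec n ` (fmod n :: (nat \<Rightarrow> ('v, 'k::field) mpoly) set)"
proof (rule equalityI; rule subsetI)
  fix v :: "('v, 'k) mpoly vec"
  assume v: "v \<in> free_module V n"
  have mem: "(\<lambda>j. if j < n then v $ j else 0) \<in> fmod n"
    using v by (auto simp: free_module_def fmod_def vec_set_def)
  have eq: "v = vec n (\<lambda>j. if j < n then v $ j else 0)"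
    using v by (intro eq_vecI) (auto simp: free_module_def)
  show "v \<in> vec n ` fmod n" by (rule image_eqI[where f = "vec n", OF eq mem])
next
  fix v :: "('v, 'k) mpoly vec"
  assume "v \<in> vec n ` fmod n"
  thus "v \<in> free_module V n"
    by (auto simp: free_module_def fmod_def vec_set_def)
qed

lemma inj_on_vec_fmod: "inj_on (vec n) (fmod n :: (nat \<Rightarrow> ('v, 'k::field) mpoly) set)"
proof (intro inj_onI ext)
  fix u w :: "nat \<Rightarrow> ('v, 'k) mpoly" and j
  assume u: "u \<in> fmod n" "w \<in> fmod n" and eq: "vec n u = vec n w"
  show "u j = w j"
  proof (cases "j < n")
    case True
    thus ?thesis using arg_cong[OF eq, of "\<lambda>v. v $ j"] by simp
  qed (use u in \<open>simp add: fmod_def\<close>)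
qed

lemma mat_image_eq:
  assumes "A \<in> carrier_mat m n"
  shows "(\<lambda>v. A *\<^sub>v v) ` free_module V n = vec m ` (linmap m n (\<lambda>p q. A $$ (p, q)) ` fmod n)"
  unfolding free_module_eq image_image using mult_mat_vec_fun[OF assms] by simp

lemma mat_kernel_eq:
  assumes "A \<in> carrier_mat m n"
  shows "{v \<in> free_module V n. A *\<^sub>v v = 0\<^sub>v m} = vec n ` {u \<in> fmod n. linmap m n (\<lambda>p q. A $$ (p, q)) u = 0}"
proof -
  have "A *\<^sub>v vec n u = 0\<^sub>v m \<longleftrightarrow> linmap m n (\<lambda>p q. A $$ (p, q)) u = 0" for u
  proof -
    have "vec m (linmap m n (\<lambda>p q. A $$ (p, q)) u) = 0\<^sub>v m \<longleftrightarrow>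
        (\<forall>i<m. linmap m n (\<lambda>p q. A $$ (p, q)) u i = 0)"
      by (metis (no_types, lifting) eq_vecI index_vec index_zero_vec dim_vec)
    also have "\<dots> \<longleftrightarrow> (\<forall>i. linmap m n (\<lambda>p q. A $$ (p, q)) u i = 0)"
      by (auto simp: linmap_def)
    finally show ?thesis by (simp add: mult_mat_vec_fun[OF assms] fun_eq_iff)
  qed
  thus ?thesis unfolding free_module_eq by auto
qed

definition res_map :: "(nat \<Rightarrow> nat list) \<Rightarrow> (nat \<Rightarrow> ('v, 'k::field) mpoly mat) \<Rightarrow> nat \<Rightarrow> (nat \<Rightarrow> ('v, 'k) mpoly) \<Rightarrow> nat \<Rightarrow> ('v, 'k) mpoly"
  where "res_map s D i = linmap (length (target_shifts s i)) (length (s i)) (\<lambda>p q. D i $$ (p, q))"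

text \<open>The ideal as a submodule of the free module of rank one, so that the augmentation is
  handled like any other differential.\<close>

definition ideal_module :: "('v, 'k::field) mpoly set \<Rightarrow> (nat \<Rightarrow> ('v, 'k) mpoly) set" where
  "ideal_module I = {u \<in> fmod 1. u 0 \<in> I}"

lemma res_map_0_fmod:
  assumes "hom_mat (target_shifts s 0) (s 0) (\<lambda>p q. D 0 $$ (p, q))" "u \<in> fmod (length (s 0))"
  shows "res_map s D 0 u \<in> fmod 1"
  using linmap_fmod[OF assms] by (simp add: res_map_def target_shifts_def)

lemma fmod_1_eqI: "u \<in> fmod 1 \<Longrightarrow> w \<in> fmod 1 \<Longrightarrow> u 0 = w 0 \<Longrightarrow> u = w"
  by (rule ext) (case_tac x, auto simp: fmod_def)

lemma homogeneous_map_iff: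
  "elements_mat A \<subseteq> poly_carrier V \<and> homogeneous_map t s A \<longleftrightarrow>
    A \<in> carrier_mat (length t) (length s) \<and> hom_mat t s (\<lambda>p q. A $$ (p, q))"
  (is "?l \<longleftrightarrow> ?r")
proof
  assume l: ?l
  hence A: "A \<in> carrier_mat (length t) (length s)" by (simp add: homogeneous_map_def)
  have "A $$ (p, q) \<in> poly_carrier V" if "p < length t" "q < length s" for p q
    using l elements_matI[OF A that refl] by blast
  thus ?r using l A by (simp add: homogeneous_map_def hom_mat_def)
next
  assume r: ?r
  hence "elements_mat A \<subseteq> poly_carrier V"
    by (auto simp: hom_mat_def dest!: elements_matD)
  thus ?l using r by (simp add: homogeneous_map_def hom_mat_def)
qed

text \<open>\<open>vec n\<close> maps \<open>fmod n\<close> bijectively onto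
  \<open>free_module V n\<close> and turns \<open>linmap\<close> into matrix multiplication, so
  images and kernels can be compared on either side. The augmentation is separate because its
  definition reads off the single entry of the result.\<close>

lemma minimal_graded_free_resolution_iff:
  fixes I :: "('v, 'k::field) mpoly set"
  assumes I: "I \<subseteq> poly_carrier V"
  shows "minimal_graded_free_resolution V I s D \<longleftrightarrow>
    (\<forall>i. D i \<in> carrier_mat (length (target_shifts s i)) (length (s i)) \<and>
         hom_mat (target_shifts s i) (s i) (\<lambda>p q. D i $$ (p, q))) \<and>
    res_map s D 0 ` fmod (length (s 0)) = ideal_module I \<and>
    (\<forall>i. res_map s D (Suc i) ` fmod (length (s (Suc i))) = {u \<in> fmod (length (s i)). res_map s D i u = 0}) \<and>
    (\<forall>i. \<forall>a\<in>elements_mat (D (Suc i)). Poly_Mapping.lookup a 0 = 0)"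
proof -
  let ?H = "\<forall>i. D i \<in> carrier_mat (length (target_shifts s i)) (length (s i)) \<and>
         hom_mat (target_shifts s i) (s i) (\<lambda>p q. D i $$ (p, q))"
  have 2: "(\<lambda>v. (D 0 *\<^sub>v v) $ 0) ` free_module V (length (s 0)) = I \<longleftrightarrow>
      res_map s D 0 ` fmod (length (s 0)) = ideal_module I" if H: ?H
  proof -
    have D0: "D 0 \<in> carrier_mat 1 (length (s 0))" using spec[OF H, of 0] by (simp add: target_shifts_def)
    have R: "res_map s D 0 u \<in> fmod 1" if "u \<in> fmod (length (s 0))" for u
      by (rule res_map_0_fmod) (use H that in auto)
    have "(\<lambda>v. (D 0 *\<^sub>v v) $ 0) ` free_module V (length (s 0)) = (\<lambda>u. res_map s D 0 u 0) ` fmod (length (s 0))"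
      unfolding free_module_eq image_image
      by (simp add: mult_mat_vec_fun[OF D0] res_map_def target_shifts_def)
    also have "\<dots> = I \<longleftrightarrow> res_map s D 0 ` fmod (length (s 0)) = ideal_module I"
    proof
      assume eq: "(\<lambda>u. res_map s D 0 u 0) ` fmod (length (s 0)) = I"
      show "res_map s D 0 ` fmod (length (s 0)) = ideal_module I"
      proof (rule equalityI; rule subsetI)
        fix x assume "x \<in> res_map s D 0 ` fmod (length (s 0))"
        thus "x \<in> ideal_module I" using R eq by (auto simp: ideal_module_def)
      next
        fix x assume x: "x \<in> ideal_module I"
        hence "x 0 \<in> (\<lambda>u. res_map s D 0 u 0) ` fmod (length (s 0))"
          using eq by (simp add: ideal_module_def)
        then obtain u where u: "u \<in> fmod (length (s 0))" "x 0 = res_map s D 0 u 0" by (rule imageE)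
        have "x = res_map s D 0 u"
          by (rule fmod_1_eqI) (use x R u in \<open>auto simp: ideal_module_def\<close>)
        thus "x \<in> res_map s D 0 ` fmod (length (s 0))" using u(1) by (rule image_eqI)
      qed
    next
      assume eq: "res_map s D 0 ` fmod (length (s 0)) = ideal_module I"
      have "(\<lambda>u. res_map s D 0 u 0) ` fmod (length (s 0)) = (\<lambda>x. x 0) ` ideal_module I"
        unfolding eq[symmetric] image_image ..
      also have "\<dots> = I"
      proof (rule equalityI; rule subsetI)
        fix a assume "a \<in> I"
        hence "(\<lambda>j. if j = 0 then a else 0) \<in> ideal_module I"
          using I by (auto simp: ideal_module_def fmod_def)
        thus "a \<in> (\<lambda>x. x 0) ` ideal_module I" by (rule rev_image_eqI) simp
      qed (auto simp: ideal_module_def)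
      finally show "(\<lambda>u. res_map s D 0 u 0) ` fmod (length (s 0)) = I" .
    qed
    finally show ?thesis .
  qed
  have 3: "(\<lambda>v. D (Suc i) *\<^sub>v v) ` free_module V (length (s (Suc i))) =
        {v \<in> free_module V (length (s i)). D i *\<^sub>v v = 0\<^sub>v (length (target_shifts s i))} \<longleftrightarrow>
      res_map s D (Suc i) ` fmod (length (s (Suc i))) = {u \<in> fmod (length (s i)). res_map s D i u = 0}"
    if H: ?H for i
  proof -
    have c: "D (Suc i) \<in> carrier_mat (length (s i)) (length (s (Suc i)))"
      "D i \<in> carrier_mat (length (target_shifts s i)) (length (s i))"
      "hom_mat (s i) (s (Suc i)) (\<lambda>p q. D (Suc i) $$ (p, q))"
      using spec[OF H, of "Suc i"] spec[OF H, of i] by (simp_all add: target_shifts_def)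
    have t: "target_shifts s (Suc i) = s i" by (simp add: target_shifts_def)
    have sub: "linmap (length (s i)) (length (s (Suc i))) (\<lambda>p q. D (Suc i) $$ (p, q)) ` fmod (length (s (Suc i)))
        \<subseteq> fmod (length (s i))"
      using linmap_fmod[OF c(3)] by (rule image_subsetI)
    show ?thesis
      unfolding mat_image_eq[OF c(1)] mat_kernel_eq[OF c(2)] res_map_def t
      by (rule inj_on_image_eq_iff[OF inj_on_vec_fmod sub]) (rule Collect_restrict)
  qed
  show ?thesis
    unfolding minimal_graded_free_resolution_def homogeneous_map_iff
  proof (rule conj_cong[OF refl])
    assume H: ?H
    show "((\<lambda>v. (D 0 *\<^sub>v v) $ 0) ` free_module V (length (s 0)) = I \<and>
        (\<forall>i. (\<lambda>v. D (Suc i) *\<^sub>v v) ` free_module V (length (s (Suc i))) =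
          {v \<in> free_module V (length (s i)). D i *\<^sub>v v = 0\<^sub>v (length (target_shifts s i))}) \<and>
        (\<forall>i. \<forall>a\<in>elements_mat (D (Suc i)). Poly_Mapping.lookup a 0 = 0)) \<longleftrightarrow>
      (res_map s D 0 ` fmod (length (s 0)) = ideal_module I \<and>
        (\<forall>i. res_map s D (Suc i) ` fmod (length (s (Suc i))) =
          {u \<in> fmod (length (s i)). res_map s D i u = 0}) \<and>
        (\<forall>i. \<forall>a\<in>elements_mat (D (Suc i)). Poly_Mapping.lookup a 0 = 0))"
      by (simp only: 2[OF H] 3[OF H])
  qed
qed

section \<open>Shifts and existence of minimal resolutions\<close>

lemma res_map_minimal:
  assumes "\<forall>a\<in>elements_mat (D (Suc i)). Poly_Mapping.lookup a 0 = 0"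
    and "D (Suc i) \<in> carrier_mat (length (s i)) (length (s (Suc i)))"
  shows "Poly_Mapping.lookup (res_map s D (Suc i) u p) 0 = 0"
proof (rule ccontr)
  assume "Poly_Mapping.lookup (res_map s D (Suc i) u p) 0 \<noteq> 0"
  hence p: "p < length (s i)"
    and "0 \<in> Poly_Mapping.keys (\<Sum>q<length (s (Suc i)). D (Suc i) $$ (p, q) * u q)"
    by (auto simp: res_map_def linmap_def target_shifts_def in_keys_iff split: if_splits)
  then obtain q where q: "q < length (s (Suc i))" "0 \<in> Poly_Mapping.keys (D (Suc i) $$ (p, q) * u q)"
    by (auto elim: in_keys_sumE)
  then obtain a b where ab: "a \<in> Poly_Mapping.keys (D (Suc i) $$ (p, q))" "0 = a + b"
    by (elim in_keys_multE)
  have "mon_degree (a + b) = 0" using ab(2)[symmetric] by simp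
  hence "a = 0" by (simp add: mon_degree_add mon_degree_eq_0_iff)
  thus False using ab(1) assms(1) elements_matI[OF assms(2) p q(1) refl] by (auto simp: in_keys_iff)
qed

text \<open>Upper bound: by induction the image of the \<open>i\<close>-th map satisfies
  \<open>reg_le\<close> with \<open>r + i\<close>. Lower bound: a zero column would put a basis
  element into a kernel free of constant coefficients, so each column has a nonzero entry; as this
  entry has no constant term, the shift exceeds one from the step before.\<close>

lemma minimal_resolution_bounds:
  fixes I :: "('v, 'k::field) mpoly set"
  assumes I: "I \<subseteq> poly_carrier V" and reg: "reg_le (ideal_module I) [0] r"
    and res: "minimal_graded_free_resolution V I s D"
    and d: "d \<in> set (s i)"
  shows "i \<le> d \<and> d \<le> r + i"
proof -
  note R = res[unfolded minimal_graded_free_resolution_iff[OF I]]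
  have hom: "hom_mat (target_shifts s i) (s i) (\<lambda>p q. D i $$ (p, q))" for i using R by blast
  have carrier: "D (Suc i) \<in> carrier_mat (length (s i)) (length (s (Suc i)))" for i
  proof -
    have "D (Suc i) \<in> carrier_mat (length (target_shifts s (Suc i))) (length (s (Suc i)))" using R by blast
    thus ?thesis by (simp add: target_shifts_def)
  qed
  have image_0: "res_map s D 0 ` fmod (length (s 0)) = ideal_module I" using R by blast
  have exact: "res_map s D (Suc i) ` fmod (length (s (Suc i))) = {u \<in> fmod (length (s i)). res_map s D i u = 0}"
    for i using R by blast
  have const: "\<forall>a\<in>elements_mat (D (Suc i)). Poly_Mapping.lookup a 0 = 0" for i using R by blast
  have kernel_const: "Poly_Mapping.lookup (u q) 0 = 0"
    if "u \<in> fmod (length (s i))" "res_map s D i u = 0" for u i q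
  proof -
    have "u \<in> res_map s D (Suc i) ` fmod (length (s (Suc i)))"
      unfolding exact using that by blast
    then obtain w where "u = res_map s D (Suc i) w" by (rule imageE)
    thus ?thesis using res_map_minimal[where i = i and D = D and s = s, OF const carrier] by (simp only:)
  qed
  have gens: "minimal_gens (target_shifts s i) (s i) (\<lambda>p q. D i $$ (p, q))" for i
    unfolding minimal_gens_def using hom kernel_const by (simp add: res_map_def)
  have reg_i: "reg_le (res_map s D i ` fmod (length (s i))) (target_shifts s i) (r + i)" for i
  proof (induction i)
    case 0
    show ?case unfolding image_0 using reg by (simp add: target_shifts_def)
  next
    case (Suc i)
    show ?case
      using minimal_gens_kernel(2)[OF gens Suc[unfolded res_map_def]]
      unfolding exact by (simp add: res_map_def target_shifts_def)
  qed
  have upper: "d \<le> r + i" if "d \<in> set (s i)" for d i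
    using that minimal_gens_kernel(1)[OF gens reg_i[unfolded res_map_def]] by (auto simp: in_set_conv_nth)
  have lower: "i \<le> d" if "d \<in> set (s i)" for d i
    using that
  proof (induction i arbitrary: d)
    case (Suc i)
    then obtain q where q: "q < length (s (Suc i))" "d = s (Suc i) ! q" by (auto simp: in_set_conv_nth)
    have "\<exists>p<length (s i). D (Suc i) $$ (p, q) \<noteq> 0"
    proof (rule ccontr)
      assume "\<not> ?thesis"
      hence "res_map s D (Suc i) (basis_elem q) = 0"
        using q(1) by (auto simp: res_map_def linmap_basis_elem target_shifts_def fun_eq_iff)
      thus False
        using kernel_const[OF basis_elem_fmod[OF q(1)], of q] by (simp add: basis_elem_def)
    qed
    then obtain p m where p: "p < length (s i)" and m: "m \<in> Poly_Mapping.keys (D (Suc i) $$ (p, q))"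
      by (metis all_not_in_conv keys_eq_empty)
    have "m \<noteq> 0"
      using m const[of i] elements_matI[OF carrier p q(1) refl] by (auto simp: in_keys_iff)
    hence "mon_degree m \<ge> 1" using mon_degree_eq_0_iff[of m] by linarith
    moreover have "mon_degree m + s i ! p = d"
      using hom[of "Suc i"] p q m by (simp add: hom_mat_def target_shifts_def)
    moreover have "i \<le> s i ! p" using Suc.IH[of "s i ! p"] p by simp
    ultimately show ?case by linarith
  qed simp
  show ?thesis using upper[OF d] lower[OF d] by blast
qed

text \<open>Dependent choice on triples of target shifts, source shifts and matrix. The bound
  \<open>r + n\<close> has to travel along in \<open>P\<close>, because finite generation of the
  next kernel depends on it.\<close>

lemma minimal_resolution_exists:
  fixes I :: "('v, 'k::field) mpoly set"
  assumes I: "I \<subseteq> poly_carrier V" and reg: "reg_le (ideal_module I) [0] r"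
    and sub: "submod 1 (ideal_module I)" and graded: "\<And>u d. u \<in> ideal_module I \<Longrightarrow> hcomp [0] d u \<in> ideal_module I"
  shows "\<exists>s D. minimal_graded_free_resolution V I s D"
proof -
  define im where "im x = linmap (length (fst x)) (length (fst (snd x))) (snd (snd x)) ` fmod (length (fst (snd x)))"
    for x :: "nat list \<times> nat list \<times> (nat \<Rightarrow> nat \<Rightarrow> ('v, 'k) mpoly)"
  define P where "P n x \<longleftrightarrow> minimal_gens (fst x) (fst (snd x)) (snd (snd x)) \<and> reg_le (im x) (fst x) (r + n) \<and>
      (n = 0 \<longrightarrow> fst x = [0] \<and> im x = ideal_module I)" for n :: nat and x
  define Q where "Q x y \<longleftrightarrow> fst y = fst (snd x) \<and> im y = {u \<in> fmod (length (fst (snd x))).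
      linmap (length (fst x)) (length (fst (snd x))) (snd (snd x)) u = 0}"
    for x y :: "nat list \<times> nat list \<times> (nat \<Rightarrow> nat \<Rightarrow> ('v, 'k) mpoly)"
  have "\<exists>x. P 0 x"
  proof -
    obtain s A where "minimal_gens [0] s A" "linmap (length [0]) (length s) A ` fmod (length s) = ideal_module I"
      using minimal_gens_exist[of "[0]" "ideal_module I" r] sub graded reg by auto
    hence "P 0 ([0], s, A)" using reg by (simp add: P_def im_def)
    thus ?thesis by (rule exI)
  qed
  moreover have "\<exists>y. P (Suc n) y \<and> Q x y" if "P n x" for n x
  proof -
    obtain t s A where x: "x = (t, s, A)" by (cases x)
    have g: "minimal_gens t s A" and rg: "reg_le (linmap (length t) (length s) A ` fmod (length s)) t (r + n)"
      using that by (simp_all add: P_def x im_def)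
    obtain s' A' where s': "minimal_gens s s' A'"
      "linmap (length s) (length s') A' ` fmod (length s') = {u \<in> fmod (length s). linmap (length t) (length s) A u = 0}"
      by (rule minimal_gens_step[OF g rg])
    have "P (Suc n) (s, s', A') \<and> Q x (s, s', A')"
      using s' minimal_gens_kernel(2)[OF g rg] by (simp add: P_def Q_def x im_def)
    thus ?thesis by (rule exI)
  qed
  ultimately have "\<exists>f. \<forall>n. P n (f n) \<and> Q (f n) (f (Suc n))"
    by (rule dependent_nat_choice)
  then obtain f where f: "\<forall>n. P n (f n) \<and> Q (f n) (f (Suc n))" by (rule exE)
  have fP: "P n (f n)" and fQ: "Q (f n) (f (Suc n))" for n using f by blast+
  define s where "s n = fst (snd (f n))" for n
  define A where "A n = snd (snd (f n))" for n
  define D where "D n = mat (length (target_shifts s n)) (length (s n)) (\<lambda>(p, q). A n p q)" for n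
  have t: "fst (f n) = target_shifts s n" for n
    using fP[of 0] fQ[of "n - 1"] by (cases n) (simp_all add: P_def Q_def target_shifts_def s_def)
  have gens: "minimal_gens (target_shifts s n) (s n) (A n)" for n
    using fP[of n] by (simp add: P_def t s_def A_def)
  have R: "res_map s D n = linmap (length (target_shifts s n)) (length (s n)) (A n)" for n
    unfolding res_map_def by (rule linmap_cong) (simp add: D_def)
  have im: "im (f n) = res_map s D n ` fmod (length (s n))" for n
    by (simp add: im_def R t s_def A_def)
  have exact: "res_map s D (Suc n) ` fmod (length (s (Suc n))) = {u \<in> fmod (length (s n)). res_map s D n u = 0}" for n
    using conjunct2[OF fQ[of n, unfolded Q_def]] unfolding im
    by (simp only: R t s_def[symmetric] A_def[symmetric])
  have "minimal_graded_free_resolution V I s D"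
    unfolding minimal_graded_free_resolution_iff[OF I]
  proof (intro conjI allI ballI exact)
    fix n
    show "D n \<in> carrier_mat (length (target_shifts s n)) (length (s n))" by (simp add: D_def)
    show "hom_mat (target_shifts s n) (s n) (\<lambda>p q. D n $$ (p, q))"
      using gens[of n] hom_mat_cong[of "target_shifts s n" "s n" "\<lambda>p q. D n $$ (p, q)" "A n"]
      by (simp add: minimal_gens_def D_def)
  next
    show "res_map s D 0 ` fmod (length (s 0)) = ideal_module I"
      using fP[of 0] by (simp add: P_def im)
  next
    fix n a assume "a \<in> elements_mat (D (Suc n))"
    then obtain p q where pq: "p < length (s n)" "q < length (s (Suc n))" "a = A (Suc n) p q"
      by (auto simp: D_def target_shifts_def dest!: elements_matD)
    \<comment> \<open>A column of the next matrix is the image of a basis element. By exactness it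
      is a relation for the previous generators, and minimality of these excludes constant
      terms.\<close>
    have "res_map s D (Suc n) (basis_elem q) \<in> {u \<in> fmod (length (s n)). res_map s D n u = 0}"
      using basis_elem_fmod[OF pq(2)] exact[of n] by blast
    hence "Poly_Mapping.lookup (res_map s D (Suc n) (basis_elem q) p) 0 = 0"
      using gens[of n] by (simp add: minimal_gens_def R)
    thus "Poly_Mapping.lookup a 0 = 0"
      using pq by (simp add: R linmap_basis_elem target_shifts_def)
  qed
  thus ?thesis by blast
qed

end


section \<open>Monomial ideals\<close>

lemma cring_poly_ring: "cring (poly_ring V :: ('v, 'k::field) mpoly ring)"
proof (intro cringI abelian_groupI comm_monoidI)
  fix x :: "('v, 'k) mpoly"
  assume "x \<in> carrier (poly_ring V)"
  thus "\<exists>y\<in>carrier (poly_ring V). y \<oplus>\<^bsub>poly_ring V\<^esub> x = \<zero>\<^bsub>poly_ring V\<^esub>"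
    by (intro bexI[of _ "- x"]) (auto simp: poly_ring_def poly_carrier_uminus)
qed (auto simp: poly_ring_def poly_carrier_intros algebra_simps)

lemma poly_ring_simps [simp]:
  "carrier (poly_ring V) = poly_carrier V" "x \<otimes>\<^bsub>poly_ring V\<^esub> y = x * y"
  "x \<oplus>\<^bsub>poly_ring V\<^esub> y = x + y" "\<zero>\<^bsub>poly_ring V\<^esub> = 0" "\<one>\<^bsub>poly_ring V\<^esub> = 1"
  by (simp_all add: poly_ring_def)

definition mon_ideal :: "'v mon set \<Rightarrow> ('v, 'k::field) mpoly set" where
  "mon_ideal U = {p. Poly_Mapping.keys p \<subseteq> U}"

definition mon_upset :: "'v set \<Rightarrow> 'v mon set \<Rightarrow> bool" where
  "mon_upset V U \<longleftrightarrow> (\<forall>m\<in>U. Poly_Mapping.keys m \<subseteq> V \<and> (\<forall>c. Poly_Mapping.keys c \<subseteq> V \<longrightarrow> m + c \<in> U))"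

definition mon_multiples :: "'v set \<Rightarrow> 'v mon set \<Rightarrow> 'v mon set" where
  "mon_multiples V B = {b + c | b c. b \<in> B \<and> Poly_Mapping.keys c \<subseteq> V}"

lemma mon_ideal_mult:
  assumes "mon_upset V U" "p \<in> mon_ideal U" "x \<in> poly_carrier V"
  shows "x * p \<in> mon_ideal U"
proof -
  have "m \<in> U" if m: "m \<in> Poly_Mapping.keys (x * p)" for m
  proof -
    obtain a b where ab: "a \<in> Poly_Mapping.keys x" "b \<in> Poly_Mapping.keys p" "m = b + a"
      using keys_mult[of x p] m by (auto simp: add.commute)
    have "b \<in> U" using assms(2) ab(2) by (auto simp: mon_ideal_def)
    thus ?thesis using assms(1) poly_carrierD[OF assms(3) ab(1)] unfolding ab(3) mon_upset_def by blast
  qed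
  thus ?thesis by (auto simp: mon_ideal_def)
qed

lemma mon_ideal_carrier: "mon_upset V U \<Longrightarrow> mon_ideal U \<subseteq> poly_carrier V"
  by (auto simp: mon_ideal_def mon_upset_def poly_carrier_def)

lemma mon_ideal_add: "p \<in> mon_ideal U \<Longrightarrow> q \<in> mon_ideal U \<Longrightarrow> p + q \<in> mon_ideal U"
  using keys_add[of p q] by (auto simp: mon_ideal_def)

lemma single_mem_mon_ideal [simp]: "c \<noteq> 0 \<Longrightarrow> Poly_Mapping.single m c \<in> mon_ideal U \<longleftrightarrow> m \<in> U"
  by (simp add: mon_ideal_def)

lemma mon_ideal_inject:
  assumes "(mon_ideal U :: ('v, 'k::field) mpoly set) = mon_ideal U'"
  shows "U = U'"
proof (rule Set.set_eqI)
  fix m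
  have "(Poly_Mapping.single m 1 :: ('v, 'k) mpoly) \<in> mon_ideal U \<longleftrightarrow> Poly_Mapping.single m 1 \<in> (mon_ideal U' :: ('v, 'k) mpoly set)"
    using assms by simp
  thus "m \<in> U \<longleftrightarrow> m \<in> U'" by simp
qed

lemma ideal_mon_ideal:
  assumes "mon_upset V U"
  shows "ideal (mon_ideal U) (poly_ring V :: ('v, 'k::field) mpoly ring)"
proof -
  interpret cring "poly_ring V :: ('v, 'k) mpoly ring" by (rule cring_poly_ring)
  have neg: "\<ominus>\<^bsub>poly_ring V\<^esub> x = - x" if "x \<in> poly_carrier V" for x :: "('v, 'k) mpoly"
    using that by (intro minus_equality) (auto simp: poly_carrier_uminus)
  show ?thesis
  proof (rule idealI)
    show "subgroup (mon_ideal U) (add_monoid (poly_ring V :: ('v, 'k) mpoly ring))"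
    proof (rule subgroup.intro)
      show "mon_ideal U \<subseteq> carrier (add_monoid (poly_ring V :: ('v, 'k) mpoly ring))"
        using mon_ideal_carrier[OF assms] by simp
      show "\<one>\<^bsub>add_monoid (poly_ring V)\<^esub> \<in> (mon_ideal U :: ('v, 'k) mpoly set)"
        by (simp add: mon_ideal_def)
    next
      fix x y :: "('v, 'k) mpoly"
      assume "x \<in> mon_ideal U" "y \<in> mon_ideal U"
      thus "x \<otimes>\<^bsub>add_monoid (poly_ring V)\<^esub> y \<in> mon_ideal U" by (simp add: mon_ideal_add)
    next
      fix x :: "('v, 'k) mpoly"
      assume x: "x \<in> mon_ideal U"
      hence "inv\<^bsub>add_monoid (poly_ring V)\<^esub> x = - x"
        using neg[of x] mon_ideal_carrier[OF assms] by (auto simp: a_inv_def)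
      thus "inv\<^bsub>add_monoid (poly_ring V)\<^esub> x \<in> mon_ideal U"
        using x by (auto simp: mon_ideal_def in_keys_iff)
    qed
  qed (use mon_ideal_mult[OF assms] ring_axioms in \<open>auto simp: mult.commute\<close>)
qed

lemma poly_mem_by_terms:
  fixes p :: "('v, 'k::field) mpoly"
  assumes "0 \<in> S" "\<And>p q. p \<in> S \<Longrightarrow> q \<in> S \<Longrightarrow> p + q \<in> S"
    and "\<And>m. m \<in> Poly_Mapping.keys p \<Longrightarrow> Poly_Mapping.single m (Poly_Mapping.lookup p m) \<in> S"
  shows "p \<in> S"
proof -
  have "(\<Sum>m\<in>K. Poly_Mapping.single m (Poly_Mapping.lookup p m)) \<in> S"
    if "finite K" "K \<subseteq> Poly_Mapping.keys p" for K
    using that by (induction K rule: finite_induct) (auto intro: assms)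
  from this[of "Poly_Mapping.keys p"] show ?thesis by (simp add: sum_single_lookup)
qed

lemma mon_upset_multiples:
  fixes B :: "'v mon set"
  assumes "\<And>b. b \<in> B \<Longrightarrow> Poly_Mapping.keys b \<subseteq> V"
  shows "mon_upset V (mon_multiples V B)"
  unfolding mon_upset_def
proof (intro ballI conjI allI impI)
  fix m :: "'v mon" assume "m \<in> mon_multiples V B"
  then obtain b c where m: "m = b + c" "b \<in> B" "Poly_Mapping.keys c \<subseteq> V" by (auto simp: mon_multiples_def)
  show "Poly_Mapping.keys m \<subseteq> V" using m assms by (auto simp: mon_keys_add)
  fix d :: "'v mon" assume d: "Poly_Mapping.keys d \<subseteq> V"
  have "m + d = b + (c + d)" "Poly_Mapping.keys (c + d) \<subseteq> V"
    using m d by (auto simp: mon_keys_add add.assoc)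
  thus "m + d \<in> mon_multiples V B" using m(2) unfolding mon_multiples_def by blast
qed

lemma genideal_monomials:
  assumes B: "\<And>b. b \<in> B \<Longrightarrow> Poly_Mapping.keys b \<subseteq> V"
  shows "Idl\<^bsub>poly_ring V\<^esub> (monomial ` B) = (mon_ideal (mon_multiples V B) :: ('v, 'k::field) mpoly set)"
proof -
  interpret cring "poly_ring V :: ('v, 'k) mpoly ring" by (rule cring_poly_ring)
  let ?B = "monomial ` B :: ('v, 'k) mpoly set"
  have sub: "?B \<subseteq> carrier (poly_ring V)"
    using B by (auto simp: monomial_def intro!: poly_carrier_single)
  interpret I: ideal "Idl\<^bsub>poly_ring V\<^esub> ?B" "poly_ring V"
    by (rule genideal_ideal[OF sub])
  have up: "mon_upset V (mon_multiples V B)" by (rule mon_upset_multiples) (rule B)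
  have "?B \<subseteq> mon_ideal (mon_multiples V B)"
  proof (rule image_subsetI)
    fix b assume "b \<in> B"
    hence "b + 0 \<in> mon_multiples V B" unfolding mon_multiples_def by fastforce
    thus "(monomial b :: ('v, 'k) mpoly) \<in> mon_ideal (mon_multiples V B)" by (simp add: monomial_def)
  qed
  hence "Idl\<^bsub>poly_ring V\<^esub> ?B \<subseteq> mon_ideal (mon_multiples V B)"
    by (rule genideal_minimal[OF ideal_mon_ideal[OF up]])
  moreover have "p \<in> Idl\<^bsub>poly_ring V\<^esub> ?B" if p: "p \<in> mon_ideal (mon_multiples V B)" for p
  proof (rule poly_mem_by_terms)
    show "0 \<in> Idl\<^bsub>poly_ring V\<^esub> ?B" using I.zero_closed by simp
    show "x + y \<in> Idl\<^bsub>poly_ring V\<^esub> ?B" if "x \<in> Idl\<^bsub>poly_ring V\<^esub> ?B" "y \<in> Idl\<^bsub>poly_ring V\<^esub> ?B" for x y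
      using I.a_closed[OF that] by simp
    fix m assume "m \<in> Poly_Mapping.keys p"
    then obtain b c where m: "m = b + c" "b \<in> B" "Poly_Mapping.keys c \<subseteq> V"
      using p by (auto simp: mon_ideal_def mon_multiples_def)
    let ?a = "Poly_Mapping.lookup p m"
    have "monomial b \<in> Idl\<^bsub>poly_ring V\<^esub> ?B"
      using genideal_self[OF sub] m(2) by blast
    hence "Poly_Mapping.single c ?a \<otimes>\<^bsub>poly_ring V\<^esub> monomial b \<in> Idl\<^bsub>poly_ring V\<^esub> ?B"
      by (rule I.I_l_closed) (simp add: poly_carrier_single m(3))
    thus "Poly_Mapping.single m ?a \<in> Idl\<^bsub>poly_ring V\<^esub> ?B"
      by (simp add: monomial_def mult_single m(1) add.commute)
  qed
  ultimately show ?thesis by blast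
qed

lemma minimal_monomial_generators_iff:
  fixes B :: "'v mon set"
  assumes B: "\<And>b. b \<in> B \<Longrightarrow> Poly_Mapping.keys b \<subseteq> V"
    and antichain: "\<And>b b' c. b \<in> B \<Longrightarrow> b' \<in> B \<Longrightarrow> b = b' + c \<Longrightarrow> b' = b"
  shows "minimal_monomial_generators V (Idl\<^bsub>poly_ring V\<^esub> (monomial ` B) :: ('v, 'k::field) mpoly set) B' \<longleftrightarrow> B' = B"
proof -
  have self: "b \<in> mon_multiples V X" if "b \<in> X" for b :: "'v mon" and X
  proof -
    have "b = b + 0" "Poly_Mapping.keys (0 :: 'v mon) \<subseteq> V" by simp_all
    thus ?thesis using that unfolding mon_multiples_def by blast
  qed
  have gen: "Idl\<^bsub>poly_ring V\<^esub> (monomial ` X) = (Idl\<^bsub>poly_ring V\<^esub> (monomial ` B) :: ('v, 'k) mpoly set) \<longleftrightarrow>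
      mon_multiples V X = mon_multiples V B" if "\<And>x. x \<in> X \<Longrightarrow> Poly_Mapping.keys x \<subseteq> V" for X
  proof -
    have "Idl\<^bsub>poly_ring V\<^esub> (monomial ` X) = (mon_ideal (mon_multiples V X) :: ('v, 'k) mpoly set)"
      by (rule genideal_monomials) (rule that)
    moreover have "Idl\<^bsub>poly_ring V\<^esub> (monomial ` B) = (mon_ideal (mon_multiples V B) :: ('v, 'k) mpoly set)"
      by (rule genideal_monomials) (rule B)
    ultimately show ?thesis by (auto dest: mon_ideal_inject)
  qed
  show ?thesis
  proof
    assume "B' = B"
    moreover have "mon_multiples V X \<noteq> mon_multiples V B" if X: "X \<subset> B" for X
    proof
      assume eq: "mon_multiples V X = mon_multiples V B"
      obtain b where b: "b \<in> B" "b \<notin> X" using X by blast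
      hence "b \<in> mon_multiples V X" unfolding eq by (intro self)
      then obtain b' c where "b = b' + c" "b' \<in> X" by (auto simp: mon_multiples_def)
      hence "b' = b" using antichain[OF b(1), of b' c] X by blast
      thus False using \<open>b' \<in> X\<close> b(2) by blast
    qed
    ultimately show "minimal_monomial_generators V (Idl\<^bsub>poly_ring V\<^esub> (monomial ` B) :: ('v, 'k) mpoly set) B'"
      unfolding minimal_monomial_generators_def
      using B gen by (metis (no_types, lifting) psubsetD)
  next
    assume m: "minimal_monomial_generators V (Idl\<^bsub>poly_ring V\<^esub> (monomial ` B) :: ('v, 'k) mpoly set) B'"
    hence B': "\<And>b. b \<in> B' \<Longrightarrow> Poly_Mapping.keys b \<subseteq> V"
      by (simp add: minimal_monomial_generators_def)
    have eq: "mon_multiples V B' = mon_multiples V B"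
      using m gen[of B'] B' by (simp add: minimal_monomial_generators_def)
    have min: "mon_multiples V X \<noteq> mon_multiples V B" if "X \<subset> B'" for X
    proof -
      have "\<And>x. x \<in> X \<Longrightarrow> Poly_Mapping.keys x \<subseteq> V" using that B' by blast
      thus ?thesis using m gen[of X] that by (simp add: minimal_monomial_generators_def)
    qed
    have anti': "b' = b" if "b \<in> B'" "b' \<in> B'" "b = b' + c" for b b' c
    proof (rule ccontr)
      assume ne: "b' \<noteq> b"
      have "mon_multiples V (B' - {b}) = mon_multiples V B'"
      proof (rule equalityI)
        show "mon_multiples V (B' - {b}) \<subseteq> mon_multiples V B'" by (auto simp: mon_multiples_def)
        show "mon_multiples V B' \<subseteq> mon_multiples V (B' - {b})"
        proof
          fix x assume "x \<in> mon_multiples V B'"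
          then obtain a d where x: "x = a + d" "a \<in> B'" "Poly_Mapping.keys d \<subseteq> V" by (auto simp: mon_multiples_def)
          show "x \<in> mon_multiples V (B' - {b})"
          proof (cases "a = b")
            case True
            have "x = b' + (c + d)" using x True that by (simp add: add.assoc)
            moreover have "Poly_Mapping.keys (c + d) \<subseteq> V"
              using x(3) B'[OF that(1)] that(3) by (auto simp: mon_keys_add)
            ultimately show ?thesis using that(2) ne unfolding mon_multiples_def by blast
          next
            case False
            thus ?thesis using x unfolding mon_multiples_def by blast
          qed
        qed
      qed
      thus False using min[of "B' - {b}"] eq that(1) by blast
    qed
    have sub: "X \<subseteq> Y" if XY: "mon_multiples V X = mon_multiples V Y"
      and anti: "\<And>b b' c. b \<in> X \<Longrightarrow> b' \<in> X \<Longrightarrow> b = b' + c \<Longrightarrow> b' = b" for X Y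
    proof
      fix x assume x: "x \<in> X"
      hence "x \<in> mon_multiples V Y" using self[OF x] XY by simp
      then obtain y c where y: "x = y + c" "y \<in> Y" by (auto simp: mon_multiples_def)
      hence "y \<in> mon_multiples V X" using self[OF y(2)] XY by simp
      then obtain z d where z: "y = z + d" "z \<in> X" by (auto simp: mon_multiples_def)
      have "z = x" using anti[OF x z(2), of "d + c"] y z by (simp add: add.assoc)
      hence "mon_degree (d + c) = 0" using y z by (simp add: add.assoc)
      hence "c = 0" by (simp add: mon_degree_add mon_degree_eq_0_iff)
      thus "x \<in> Y" using y by simp
    qed
    show "B' = B"
    proof (rule equalityI)
      show "B' \<subseteq> B" by (rule sub[OF eq]) (rule anti')
      show "B \<subseteq> B'" by (rule sub[OF eq[symmetric]]) (rule antichain)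
    qed
  qed
qed

section \<open>Symbolic powers as monomial ideals\<close>

text \<open>A monomial whose exponents on \<open>e\<close> sum to at least \<open>k + 1\<close>
  splits off one variable of \<open>e\<close> and leaves a sum of at least \<open>k\<close>;
  conversely, these sums add up in products. The zeroth power is the whole ring, in accordance with
  the bound 0.\<close>

lemma pow_edge_ideal:
  assumes e: "finite e" "e \<subseteq> V"
  shows "(Idl\<^bsub>poly_ring V\<^esub> (var ` e)) [^]\<^bsub>ideals_set (poly_ring V)\<^esub> (k::nat) =
    (mon_ideal {m. Poly_Mapping.keys m \<subseteq> V \<and> k \<le> (\<Sum>v\<in>e. Poly_Mapping.lookup m v)} :: ('v, 'k::field) mpoly set)"
proof -
  define U where "U k = {m. Poly_Mapping.keys m \<subseteq> V \<and> k \<le> (\<Sum>v\<in>e. Poly_Mapping.lookup m v)}" for k :: nat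
  have split: "\<exists>v\<in>e. \<exists>m'\<in>U k. m = m' + Poly_Mapping.single v 1" if "m \<in> U (Suc k)" for m k
  proof -
    have "(\<Sum>v\<in>e. Poly_Mapping.lookup m v) \<noteq> 0" using that by (simp add: U_def)
    then obtain v where v: "v \<in> e" "Poly_Mapping.lookup m v > 0" by (auto simp: sum_eq_0_iff e(1))
    obtain m' where m': "m = m' + Poly_Mapping.single v 1" using mon_split_single[OF v(2)] .
    have "(\<Sum>w\<in>e. Poly_Mapping.lookup m w) = (\<Sum>w\<in>e. Poly_Mapping.lookup m' w) + 1"
      using v(1) e(1) by (simp add: m' lookup_add sum.distrib lookup_single when_def)
    hence "m' \<in> U k" using that m' by (auto simp: U_def mon_keys_add)
    thus ?thesis using v(1) m' by blast
  qed
  have U0: "mon_ideal (U 0) = poly_carrier V" by (auto simp: U_def mon_ideal_def poly_carrier_def)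
  have U1: "mon_multiples V ((\<lambda>v. Poly_Mapping.single v 1) ` e) = U 1"
  proof (rule equalityI; rule subsetI)
    fix m assume "m \<in> mon_multiples V ((\<lambda>v. Poly_Mapping.single v 1) ` e)"
    then obtain v c where v: "v \<in> e" "m = Poly_Mapping.single v 1 + c" "Poly_Mapping.keys c \<subseteq> V"
      by (auto simp: mon_multiples_def)
    have "Poly_Mapping.lookup m v \<le> (\<Sum>w\<in>e. Poly_Mapping.lookup m w)"
      by (rule member_le_sum) (use v e in auto)
    thus "m \<in> U 1" using v e by (auto simp: U_def mon_keys_add lookup_add)
  next
    fix m assume "m \<in> U 1"
    then obtain v m' where "v \<in> e" "m' \<in> U 0" "m = Poly_Mapping.single v 1 + m'"
      using split[of m 0] by (auto simp: add.commute)
    thus "m \<in> mon_multiples V ((\<lambda>v. Poly_Mapping.single v 1) ` e)"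
      unfolding mon_multiples_def U_def by blast
  qed
  have "var ` e = (monomial ` (\<lambda>v. Poly_Mapping.single v 1) ` e :: ('v, 'k) mpoly set)"
    by (simp add: image_image var_def)
  hence Idl1: "Idl\<^bsub>poly_ring V\<^esub> (var ` e) = (mon_ideal (U 1) :: ('v, 'k) mpoly set)"
    using e(2) by (simp only: U1[symmetric]) (rule genideal_monomials, auto)
  have "(mon_ideal (U 1) :: ('v, 'k) mpoly set) [^]\<^bsub>ideals_set (poly_ring V)\<^esub> k = mon_ideal (U k)"
  proof (induction k)
    case 0
    show ?case by (simp add: ideals_set_def U0)
  next
    case (Suc k)
    let ?P = "ideal_prod (poly_ring V) (mon_ideal (U k)) (mon_ideal (U 1)) :: ('v, 'k) mpoly set"
    have "?P = mon_ideal (U (Suc k))"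
    proof (rule equalityI; rule subsetI)
      fix x assume "x \<in> ?P"
      thus "x \<in> mon_ideal (U (Suc k))"
      proof (induction x rule: ideal_prod.induct)
        case (prod i j)
        have "m \<in> U (Suc k)" if m: "m \<in> Poly_Mapping.keys (i * j)" for m
        proof -
          obtain a b where "a \<in> Poly_Mapping.keys i" "b \<in> Poly_Mapping.keys j" "m = a + b"
            using m keys_mult[of i j] by blast
          moreover from this have "a \<in> U k" "b \<in> U 1" using prod by (auto simp: mon_ideal_def)
          ultimately show ?thesis by (simp add: U_def lookup_add sum.distrib mon_keys_add)
        qed
        thus ?case by (auto simp: mon_ideal_def)
      next
        case (sum x y)
        thus ?case by (simp add: mon_ideal_add)
      qed
    next
      fix p :: "('v, 'k) mpoly" assume p: "p \<in> mon_ideal (U (Suc k))"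
      show "p \<in> ?P"
      proof (rule poly_mem_by_terms)
        have "0 \<otimes>\<^bsub>poly_ring V\<^esub> 0 \<in> ?P" by (rule ideal_prod.prod) (simp_all add: mon_ideal_def)
        thus "0 \<in> ?P" by simp
        show "x + y \<in> ?P" if "x \<in> ?P" "y \<in> ?P" for x y
          using ideal_prod.sum[OF that] by simp
        fix m assume "m \<in> Poly_Mapping.keys p"
        hence "m \<in> U (Suc k)" using p by (auto simp: mon_ideal_def)
        then obtain v m' where v: "v \<in> e" "m' \<in> U k" "m = m' + Poly_Mapping.single v 1"
          using split by blast
        have "Poly_Mapping.single v 1 \<in> U 1"
          using v(1) e by (auto simp: U_def lookup_single when_def sum.delta)
        hence "Poly_Mapping.single m' (Poly_Mapping.lookup p m) \<otimes>\<^bsub>poly_ring V\<^esub> var v \<in> ?P"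
          using v(2) by (intro ideal_prod.prod) (auto simp: var_def monomial_def mon_ideal_def)
        thus "Poly_Mapping.single m (Poly_Mapping.lookup p m) \<in> ?P"
          by (simp add: var_def monomial_def mult_single v(3))
      qed
    qed
    moreover have "I \<otimes>\<^bsub>ideals_set (poly_ring V)\<^esub> J = ideal_prod (poly_ring V) I J"
      for I J :: "('v, 'k) mpoly set"
      by (simp add: ideals_set_def)
    ultimately show ?case by (simp only: nat_pow_Suc Suc.IH)
  qed
  thus ?thesis unfolding Idl1 U_def .
qed

text \<open>The exponent vectors known as \<open>k\<close>-covers: weights on the vertices with
  total at least \<open>k\<close> on every edge.\<close>

definition symbolic_mons :: "'v ugraph \<Rightarrow> nat \<Rightarrow> 'v mon set" where
  "symbolic_mons G k = {m. Poly_Mapping.keys m \<subseteq> verts G \<and> (\<forall>e\<in>edges G. k \<le> (\<Sum>v\<in>e. Poly_Mapping.lookup m v))}"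

lemma symbolic_power_eq:
  assumes "finite_simple_graph G"
  shows "symbolic_power G k = (mon_ideal (symbolic_mons G k) :: ('v, 'k::field) mpoly set)"
proof -
  have e: "finite e" "e \<subseteq> verts G" if "e \<in> edges G" for e
    using assms that by (auto simp: finite_simple_graph_def nsets_def)
  have "symbolic_power G k = poly_carrier (verts G) \<inter> (\<Inter>e\<in>edges G.
      (mon_ideal {m. Poly_Mapping.keys m \<subseteq> verts G \<and> k \<le> (\<Sum>v\<in>e. Poly_Mapping.lookup m v)} :: ('v, 'k) mpoly set))"
    unfolding symbolic_power_def
    by (intro arg_cong2[where f = "(\<inter>)"] refl INF_cong pow_edge_ideal e)
  also have "\<dots> = mon_ideal (symbolic_mons G k)"
    by (auto simp: mon_ideal_def symbolic_mons_def poly_carrier_def)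
  finally show ?thesis .
qed


section \<open>Regularity of symbolic powers of cover ideals\<close>

lemma mon_upset_symbolic_mons: "finite_simple_graph G \<Longrightarrow> mon_upset (verts G) (symbolic_mons G k)"
  by (auto simp: mon_upset_def symbolic_mons_def mon_keys_add lookup_add sum.distrib intro: trans_le_add1)

text \<open>If \<open>v\<close> divides \<open>m\<close> but the quotient leaves the set, lowering a
  single exponent violates the condition of some edge. This edge contains \<open>v\<close> and has
  total exactly \<open>k\<close> in \<open>m\<close>; its other end is \<open>w\<close>.\<close>

lemma symbolic_mons_not_reducible:
  assumes G: "finite_simple_graph G" and m: "m \<in> symbolic_mons G k"
    and irr: "\<not> (\<exists>m'\<in>symbolic_mons G k. m = m' + Poly_Mapping.single v 1)"
  shows "Poly_Mapping.lookup m v = 0 \<or>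
    (\<exists>w. w \<in> verts G \<and> w \<noteq> v \<and> Poly_Mapping.lookup m v + Poly_Mapping.lookup m w \<le> k)"
proof (rule disj_imp[THEN iffD2], rule impI)
  assume "Poly_Mapping.lookup m v \<noteq> 0"
  hence "Poly_Mapping.lookup m v > 0" by simp
  then obtain m' where m': "m = m' + Poly_Mapping.single v 1" by (rule mon_split_single)
  hence "m' \<notin> symbolic_mons G k" using irr by blast
  moreover have "Poly_Mapping.keys m' \<subseteq> verts G" using m m' by (auto simp: symbolic_mons_def mon_keys_add)
  ultimately obtain e where e: "e \<in> edges G" "(\<Sum>u\<in>e. Poly_Mapping.lookup m' u) < k"
    by (auto simp: symbolic_mons_def not_le)
  have "e \<in> nsets (verts G) 2" using G e(1) by (auto simp: finite_simple_graph_def)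
  then obtain a b where ab: "e = {a, b}" "a \<in> verts G" "b \<in> verts G" "a \<noteq> b" by (rule nsets2_E)
  have "k \<le> (\<Sum>u\<in>e. Poly_Mapping.lookup m u)" using m e(1) by (simp add: symbolic_mons_def)
  hence 1: "k \<le> Poly_Mapping.lookup m a + Poly_Mapping.lookup m b" using ab by simp
  have 2: "Poly_Mapping.lookup m' a + Poly_Mapping.lookup m' b < k" using e(2) ab by simp
  show "\<exists>w. w \<in> verts G \<and> w \<noteq> v \<and> Poly_Mapping.lookup m v + Poly_Mapping.lookup m w \<le> k"
  proof (cases "v = a")
    case True
    thus ?thesis using 2 ab by (intro exI[of _ b]) (auto simp: m' lookup_add lookup_single when_def)
  next
    case False
    hence "v = b" using 1 2 by (auto simp: m' lookup_add lookup_single when_def split: if_splits)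
    thus ?thesis using 2 ab by (intro exI[of _ a]) (auto simp: m' lookup_add lookup_single when_def)
  qed
qed

text \<open>The \<open>card V - 2\<close> elements outside the pair contribute at most
  \<open>k\<close> each. Adding \<open>k\<close> on the left leaves \<open>card V - 1\<close>, the
  form in which the bound is used.\<close>

lemma sum_le_with_small_pair:
  fixes f :: "'a \<Rightarrow> nat"
  assumes V: "finite V" "v \<in> V" "w \<in> V" "v \<noteq> w" and le: "\<And>u. u \<in> V \<Longrightarrow> f u \<le> k" and vw: "f v + f w \<le> c"
  shows "sum f V + k \<le> c + k * (card V - 1)"
proof -
  have "sum f V = f v + f w + sum f (V - {v, w})"
    using V sum.subset_diff[of "{v, w}" V f] by simp
  moreover have "sum f (V - {v, w}) \<le> card (V - {v, w}) * k"
    using sum_bounded_above[of "V - {v, w}" f k] le by simp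
  moreover have "card (V - {v, w}) = card V - 2"
    using V by (simp add: card_Diff_subset)
  moreover have "card V \<ge> 2"
    using V card_mono[of V "{v, w}"] by simp
  then obtain n where "card V = n + 2" by (metis add.commute le_Suc_ex)
  ultimately show ?thesis using vw by (simp add: algebra_simps)
qed

context ranked_vars
begin

text \<open>
  Failure of \<open>v\<close> as an apex means that \<open>v\<close> cannot be removed from a face of multidegree \<open>a\<close>, and
  then \<open>a v \<le> k\<close>, while some other vertex \<open>w\<close> has \<open>a v + a w \<le> k + 1\<close> unless \<open>a v = 0\<close>. If all
  vertices fail, the total degree of \<open>a\<close> is too small.
\<close>

lemma coned_symbolic_mons:
  assumes G: "finite_simple_graph G" and VG: "verts G = V" and y: "y \<in> V"
    and d: "d > k * (card V - 1)"
  shows "coned (symbolic_mons G k) d p"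
  unfolding coned_def
proof (intro ballI allI impI, rule ccontr)
  let ?U = "symbolic_mons G k"
  fix m \<sigma> assume m: "m \<in> ?U" and \<sigma>: "\<sigma> \<subseteq> V" and dp: "mon_degree m = d \<and> card \<sigma> = p"
  assume "\<not> (\<exists>v\<in>V. \<forall>m'\<in>?U. \<forall>\<tau>\<subseteq>V. card \<tau> = p \<and> m' + squarefree_mon \<tau> = m + squarefree_mon \<sigma> \<and> v \<notin> \<tau>
    \<longrightarrow> (\<exists>m''\<in>?U. m' = m'' + Poly_Mapping.single v 1))"
  hence fail: "\<forall>v\<in>V. \<exists>m'\<in>?U. \<exists>\<tau>\<subseteq>V. card \<tau> = p \<and> m' + squarefree_mon \<tau> = m + squarefree_mon \<sigma> \<and> v \<notin> \<tau> \<and>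
    \<not> (\<exists>m''\<in>?U. m' = m'' + Poly_Mapping.single v 1)"
    by simp
  define a where "a = Poly_Mapping.lookup (m + squarefree_mon \<sigma>)"
  have fin_\<sigma>: "finite \<sigma>" using \<sigma> fin by (rule finite_subset)
  have keys: "Poly_Mapping.keys (m + squarefree_mon \<sigma>) \<subseteq> V"
    using m \<sigma> fin_\<sigma> VG by (auto simp: mon_keys_add symbolic_mons_def in_keys_iff lookup_squarefree_mon split: if_splits)
  have sum_a: "sum a V = d + p"
    using mon_degree_eq_sum[OF fin keys] dp fin_\<sigma>
    by (simp add: a_def mon_degree_add mon_degree_squarefree_mon)
  have bound: "a v \<le> k \<and> (a v = 0 \<or> (\<exists>w\<in>V. w \<noteq> v \<and> a v + a w \<le> k + (if p = 0 then 0 else 1)))" if v: "v \<in> V" for v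
  proof -
    obtain m' \<tau> where m': "m' \<in> ?U" "\<tau> \<subseteq> V" "card \<tau> = p" "m' + squarefree_mon \<tau> = m + squarefree_mon \<sigma>" "v \<notin> \<tau>"
      and irr: "\<not> (\<exists>m''\<in>?U. m' = m'' + Poly_Mapping.single v 1)"
      using bspec[OF fail v] by blast
    have fin_\<tau>: "finite \<tau>" using m'(2) fin by (rule finite_subset)
    have a: "a u = Poly_Mapping.lookup m' u + (if u \<in> \<tau> then 1 else 0)" for u
      unfolding a_def m'(4)[symmetric] by (simp add: lookup_add lookup_squarefree_mon[OF fin_\<tau>])
    have av: "a v = Poly_Mapping.lookup m' v" using a[of v] m'(5) by simp
    \<comment> \<open>The vertex \<open>w\<close> may belong to \<open>\<tau>\<close>, which adds
      one to its exponent; for \<open>p = 0\<close> the face is empty. This is the origin of the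
      summand 1 in \<open>k + 1\<close>.\<close>
    have aw: "a w \<le> Poly_Mapping.lookup m' w + (if p = 0 then 0 else 1)" for w
      using a[of w] m'(3) fin_\<tau> by (auto simp: card_gt_0_iff)
    from symbolic_mons_not_reducible[OF G m'(1) irr] show ?thesis
    proof
      assume "Poly_Mapping.lookup m' v = 0"
      thus ?thesis using av by simp
    next
      assume "\<exists>w. w \<in> verts G \<and> w \<noteq> v \<and> Poly_Mapping.lookup m' v + Poly_Mapping.lookup m' w \<le> k"
      then obtain w where w: "w \<in> V" "w \<noteq> v" "Poly_Mapping.lookup m' v + Poly_Mapping.lookup m' w \<le> k"
        using VG by blast
      have "a v + a w \<le> k + (if p = 0 then 0 else 1)" using aw[of w] av w(3) by linarith
      thus ?thesis using w av by auto
    qed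
  qed
  show False
  proof (cases "p = 0")
    \<comment> \<open>The total degree is \<open>d\<close> itself. Either \<open>a y = 0\<close> and
      the other vertices contribute at most \<open>k\<close> each, or a pair containing
      \<open>y\<close> contributes at most \<open>k\<close> together; in both cases the sum is at
      most \<open>k * (card V - 1)\<close>.\<close>
    case True
    show False
    proof (cases "a y = 0")
      case True
      have "sum a V = sum a (V - {y})" using fin y True by (simp add: sum.remove)
      also have "\<dots> \<le> card (V - {y}) * k"
        using sum_bounded_above[of "V - {y}" a k] bound by simp
      also have "\<dots> = k * (card V - 1)" using fin y by simp
      finally show False using sum_a d by simp
    next
      case False
      then obtain w where "w \<in> V" "w \<noteq> y" "a y + a w \<le> k" using bound[OF y] True by auto
      hence "sum a V + k \<le> k + k * (card V - 1)"
        using bound by (intro sum_le_with_small_pair[OF fin y]) auto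
      thus False using sum_a d by simp
    qed
  next
    case False
    \<comment> \<open>A vertex of the face has positive exponent, so the alternative
      \<open>a v = 0\<close> is excluded. The pair may reach \<open>k + 1\<close>, but the total
      degree is \<open>d + p\<close> with \<open>p > 0\<close>, which absorbs the extra one.\<close>
    then obtain v where v: "v \<in> \<sigma>" using dp by fastforce
    hence vV: "v \<in> V" using \<sigma> by blast
    have "a v \<noteq> 0" using v fin_\<sigma> by (simp add: a_def lookup_add lookup_squarefree_mon)
    then obtain w where "w \<in> V" "w \<noteq> v" "a v + a w \<le> k + 1" using bound[OF vV] False by auto
    hence "sum a V + k \<le> (k + 1) + k * (card V - 1)"
      using bound by (intro sum_le_with_small_pair[OF fin vV]) auto
    thus False using sum_a d False by simp
  qed
qed

lemma hcomp_mon_ideal_module: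
  assumes "u \<in> ideal_module (mon_ideal U)"
  shows "hcomp [0] d u \<in> ideal_module (mon_ideal U)"
proof -
  have "hcomp [0] d u \<in> fmod 1"
    using hcomp_fmod[of u "[0]" d] assms by (simp add: ideal_module_def)
  thus ?thesis using assms by (auto simp: ideal_module_def mon_ideal_def hcomp_def keys_poly_filter)
qed

lemma submod_mon_ideal_module:
  assumes "mon_upset V U"
  shows "submod 1 (ideal_module (mon_ideal U) :: (nat \<Rightarrow> ('v, 'k::field) mpoly) set)"
  unfolding submod_def
proof (intro conjI ballI)
  note F = submodD[OF submod_fmod[of 1]]
  show "ideal_module (mon_ideal U) \<subseteq> (fmod 1 :: (nat \<Rightarrow> ('v, 'k) mpoly) set)" by (auto simp: ideal_module_def)
  show "0 \<in> (ideal_module (mon_ideal U) :: (nat \<Rightarrow> ('v, 'k) mpoly) set)"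
    using F(2) by (simp add: ideal_module_def mon_ideal_def)
  show "u + w \<in> ideal_module (mon_ideal U)"
    if "u \<in> ideal_module (mon_ideal U)" "w \<in> ideal_module (mon_ideal U)" for u w :: "nat \<Rightarrow> ('v, 'k) mpoly"
    using that F(3)[of u w] by (simp add: ideal_module_def mon_ideal_add)
  show "smul c u \<in> ideal_module (mon_ideal U)"
    if "c \<in> poly_carrier V" "u \<in> ideal_module (mon_ideal U)" for c :: "('v, 'k) mpoly" and u
    using that F(4)[of c u] mon_ideal_mult[OF assms, of "u 0" c] by (simp add: ideal_module_def smul_def)
qed

section \<open>From coned complexes to the regularity\<close>

text \<open>Since \<open>m\<close> lies in the image of the augmentation, it is a multiple of a
  monomial \<open>a\<close> in one of its entries. Each entry is in the ideal, so \<open>a\<close>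
  is in \<open>U\<close>, and minimality gives \<open>a = m\<close>; homogeneity equates the shift
  of that column with the degree of \<open>m\<close>.\<close>

lemma minimal_generator_shift:
  fixes D :: "nat \<Rightarrow> ('v, 'k::field) mpoly mat"
  assumes U: "mon_upset V U" and m: "m \<in> U" and min: "\<And>a b. a \<in> U \<Longrightarrow> m = a + b \<Longrightarrow> b = 0"
    and res: "minimal_graded_free_resolution V (mon_ideal U) s D"
  shows "mon_degree m \<in> set (s 0)"
proof -
  note R = res[unfolded minimal_graded_free_resolution_iff[OF mon_ideal_carrier[OF U]]]
  have hom: "hom_mat (target_shifts s 0) (s 0) (\<lambda>p q. D 0 $$ (p, q))" using R by blast
  have im: "res_map s D 0 ` fmod (length (s 0)) = ideal_module (mon_ideal U)" using R by blast
  have mem: "(\<lambda>j. if j = 0 then Poly_Mapping.single m 1 else 0) \<in> (ideal_module (mon_ideal U) :: (nat \<Rightarrow> ('v, 'k) mpoly) set)"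
    using m U by (auto simp: ideal_module_def fmod_def mon_upset_def intro!: poly_carrier_single)
  then obtain u where u: "(\<lambda>j. if j = 0 then Poly_Mapping.single m 1 else 0) = res_map s D 0 u"
    unfolding im[symmetric] by (rule imageE)
  have "res_map s D 0 u 0 = Poly_Mapping.single m 1" by (simp only: u[symmetric] refl if_True)
  hence "m \<in> Poly_Mapping.keys (\<Sum>j<length (s 0). D 0 $$ (0, j) * u j)"
    by (simp add: res_map_def linmap_def target_shifts_def)
  then obtain j where j: "j < length (s 0)" "m \<in> Poly_Mapping.keys (D 0 $$ (0, j) * u j)"
    by (auto elim: in_keys_sumE)
  then obtain a b where ab: "a \<in> Poly_Mapping.keys (D 0 $$ (0, j))" "m = a + b"
    by (elim in_keys_multE)
  have "res_map s D 0 (basis_elem j) \<in> ideal_module (mon_ideal U)"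
    unfolding im[symmetric] by (rule imageI) (rule basis_elem_fmod[OF j(1)])
  hence "D 0 $$ (0, j) \<in> mon_ideal U"
    using j(1) by (simp add: ideal_module_def res_map_def linmap_basis_elem target_shifts_def)
  hence "a \<in> U" using ab(1) by (auto simp: mon_ideal_def)
  hence "m = a" using min ab(2) by fastforce
  hence "mon_degree m = s 0 ! j"
    using hom ab(1) j(1) by (simp add: hom_mat_def target_shifts_def)
  thus ?thesis using j(1) by simp
qed

text \<open>The bounds on shifts keep every difference \<open>j - i\<close> between 0 and
  \<open>r\<close>, and the minimal generator \<open>m\<close> realises \<open>r\<close> at
  \<open>i = 0\<close>.\<close>

lemma regularity_mon_ideal:
  assumes U: "mon_upset V U" and cone: "\<And>d p. d > r \<Longrightarrow> coned U d p"
    and m: "m \<in> U" "mon_degree m = r" and min: "\<And>a b. a \<in> U \<Longrightarrow> m = a + b \<Longrightarrow> b = 0"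
  shows "regularity V (mon_ideal U :: ('v, 'k::field) mpoly set) = int r"
proof -
  let ?I = "mon_ideal U :: ('v, 'k) mpoly set"
  have I: "?I \<subseteq> poly_carrier V" by (rule mon_ideal_carrier[OF U])
  have "ideal_module ?I = {u \<in> fmod (length [0::nat]). \<forall>j<length [0::nat]. Poly_Mapping.keys (u j :: ('v, 'k) mpoly) \<subseteq> U}"
    by (simp add: ideal_module_def mon_ideal_def)
  moreover have "reg_le {u \<in> fmod (length [0::nat]). \<forall>j<length [0::nat]. Poly_Mapping.keys (u j :: ('v, 'k) mpoly) \<subseteq> U} [0] r"
    by (rule reg_le_monomial[where U = "\<lambda>_. U"]) (use U cone in \<open>auto simp: mon_upset_def\<close>)
  ultimately have reg: "reg_le (ideal_module ?I) [0] r" by (simp only:)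
  have "\<exists>s D. minimal_graded_free_resolution V ?I s D"
    by (rule minimal_resolution_exists[OF I reg submod_mon_ideal_module[OF U] hcomp_mon_ideal_module])
  \<comment> \<open>Existence guarantees that the resolution selected in \<open>graded_betti\<close>
    is a minimal one.\<close>
  hence ex: "\<exists>x. case x of (s, D) \<Rightarrow> minimal_graded_free_resolution V ?I s D" by auto
  define x where "x = (SOME (s, D). minimal_graded_free_resolution V ?I s D)"
  obtain s D where sD: "x = (s, D)" by (cases x)
  have "case x of (s, D) \<Rightarrow> minimal_graded_free_resolution V ?I s D"
    unfolding x_def by (rule someI_ex[OF ex])
  hence res: "minimal_graded_free_resolution V ?I s D" by (simp add: sD)
  have betti: "graded_betti V ?I i j \<noteq> 0 \<longleftrightarrow> j \<in> set (s i)" for i j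
    unfolding graded_betti_def x_def[symmetric] sD by (simp add: count_list_0_iff)
  let ?S = "{int j - int i | i j. graded_betti V ?I i j \<noteq> 0}"
  have S: "0 \<le> z \<and> z \<le> int r" if z: "z \<in> ?S" for z
  proof -
    obtain i j where "z = int j - int i" "j \<in> set (s i)" using z betti by auto
    thus ?thesis using minimal_resolution_bounds[OF I reg res] by fastforce
  qed
  have "?S \<subseteq> {0..int r}"
    by (rule subsetI, simp only: atLeastAtMost_iff) (rule S)
  hence "finite ?S" by (rule finite_subset) simp
  moreover have "r \<in> set (s 0)"
    using minimal_generator_shift[OF U m(1) min res] m(2) by simp
  hence "graded_betti V ?I 0 r \<noteq> 0" using betti by blast
  hence "int r \<in> ?S" by force
  ultimately show ?thesis
    unfolding regularity_def using S by (intro Max_eqI) blast+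
qed

end

section \<open>The cone over a graph\<close>

lemma finite_simple_graph_cone:
  assumes "finite_simple_graph H" "y \<notin> verts H"
  shows "finite_simple_graph (cone_graph y H)"
proof -
  have "{y, v} \<in> nsets (insert y (verts H)) 2" if "v \<in> verts H" for v
  proof -
    have "y \<noteq> v" using that assms(2) by blast
    thus ?thesis using that by (simp add: nsets_def)
  qed
  moreover have "edges H \<subseteq> nsets (insert y (verts H)) 2"
    using assms(1) nsets_mono[of "verts H" "insert y (verts H)" 2] by (auto simp: finite_simple_graph_def)
  ultimately show ?thesis
    using assms(1) by (auto simp: finite_simple_graph_def cone_graph_def)
qed

text \<open>The witness \<open>m\<close> has exponent \<open>k\<close> on \<open>H\<close> and 0 at
  \<open>y\<close>. Any divisor of \<open>m\<close> in \<open>symbolic_mons\<close> also has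
  exponent 0 at \<open>y\<close>, so each edge \<open>{y, v}\<close> forces exponent
  \<open>k\<close> at \<open>v\<close>; this makes \<open>m\<close> a minimal generator.\<close>

lemma regularity_symbolic_power_cone:
  assumes H: "finite_simple_graph H" and y: "y \<notin> verts H"
  shows "regularity (verts (cone_graph y H)) (symbolic_power (cone_graph y H) k :: ('v, 'k::field) mpoly set)
    = int (k * card (verts H))"
proof -
  let ?G = "cone_graph y H" and ?V = "insert y (verts H)"
  have G: "finite_simple_graph ?G" by (rule finite_simple_graph_cone[OF H y])
  have VG: "verts ?G = ?V" by (simp add: cone_graph_def)
  have finH: "finite (verts H)" using H by (simp add: finite_simple_graph_def)
  obtain rk :: "'v \<Rightarrow> nat" where "inj_on rk ?V"
    using finite_imp_inj_to_nat_seg[of ?V] finH by blast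
  then interpret ranked_vars ?V rk using finH by unfold_locales auto
  define m :: "'v mon" where "m = (\<Sum>v\<in>verts H. Poly_Mapping.single v k)"
  have lookup_m: "Poly_Mapping.lookup m v = (if v \<in> verts H then k else 0)" for v
    using finH by (simp add: m_def lookup_sum lookup_single when_def)
  have keys_m: "Poly_Mapping.keys m \<subseteq> verts H" by (auto simp: in_keys_iff lookup_m split: if_splits)
  have deg: "mon_degree m = k * card (verts H)"
    using mon_degree_eq_sum[OF finH keys_m] by (simp add: lookup_m)
  have edge_sum: "k \<le> (\<Sum>v\<in>e. Poly_Mapping.lookup m v)" if "e \<in> edges ?G" for e
  proof -
    have "e \<in> nsets ?V 2" using G that VG by (auto simp: finite_simple_graph_def)
    then obtain a b where ab: "e = {a, b}" "a \<in> ?V" "b \<in> ?V" "a \<noteq> b" by (rule nsets2_E)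
    thus ?thesis by (auto simp: lookup_m)
  qed
  have mem: "m \<in> symbolic_mons ?G k"
    using keys_m edge_sum VG by (auto simp: symbolic_mons_def)
  have min: "b = 0" if a: "a \<in> symbolic_mons ?G k" and eq: "m = a + b" for a b
  proof (rule poly_mapping_eqI)
    fix v
    have le: "Poly_Mapping.lookup m u = Poly_Mapping.lookup a u + Poly_Mapping.lookup b u" for u
      by (simp add: eq lookup_add)
    show "Poly_Mapping.lookup b v = Poly_Mapping.lookup 0 v"
    proof (cases "v \<in> verts H")
      case True
      hence "{y, v} \<in> edges ?G" by (auto simp: cone_graph_def)
      hence "k \<le> (\<Sum>u\<in>{y, v}. Poly_Mapping.lookup a u)" using a unfolding symbolic_mons_def by blast
      moreover have "y \<noteq> v" using True y by blast
      ultimately show ?thesis using le[of y] le[of v] lookup_m[of y] lookup_m[of v] True y by simp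
    next
      case False
      thus ?thesis using le[of v] lookup_m[of v] by simp
    qed
  qed
  have cone: "coned (symbolic_mons ?G k) d p" if "d > k * card (verts H)" for d p
    by (rule coned_symbolic_mons[OF G VG]) (use that y finH in auto)
  show ?thesis
    unfolding symbolic_power_eq[OF G] VG
    by (rule regularity_mon_ideal[OF mon_upset_symbolic_mons[OF G, unfolded VG] cone mem deg min])
qed

section \<open>The degree of the cover ideal\<close>

lemma cover_ideal_eq:
  assumes "finite_simple_graph G"
  shows "cover_ideal G = (Idl\<^bsub>poly_ring (verts G)\<^esub> (monomial ` squarefree_mon ` {C. minimal_vertex_cover G C})
    :: ('v, 'k::field) mpoly set)"
proof -
  have "(\<Prod>x\<in>C. var x) = (monomial (squarefree_mon C) :: ('v, 'k) mpoly)" if "minimal_vertex_cover G C" for C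
  proof -
    have "finite C"
      using that assms finite_subset
      by (auto simp: minimal_vertex_cover_def vertex_cover_def finite_simple_graph_def)
    thus ?thesis
    proof (induction C rule: finite_induct)
      case empty
      show ?case by (simp add: monomial_def squarefree_mon_def)
    next
      case (insert v C)
      thus ?case by (simp add: squarefree_mon_insert monomial_def var_def mult_single)
    qed
  qed
  hence "(\<lambda>C. \<Prod>x\<in>C. var x) ` {C. minimal_vertex_cover G C}
      = (monomial ` squarefree_mon ` {C. minimal_vertex_cover G C} :: ('v, 'k) mpoly set)"
    unfolding image_image by (intro image_cong) auto
  moreover have "{\<Prod>x\<in>C. var x | C. minimal_vertex_cover G C}
      = (\<lambda>C. (\<Prod>x\<in>C. var x) :: ('v, 'k) mpoly) ` {C. minimal_vertex_cover G C}"
    by blast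
  ultimately show ?thesis by (simp only: cover_ideal_def)
qed

text \<open>Divisibility of squarefree monomials is inclusion of their supports, and one minimal
  cover inside another equals it. The defining generators are therefore an antichain, hence the
  minimal ones.\<close>

lemma ideal_degree_cover_ideal:
  assumes G: "finite_simple_graph G"
  shows "ideal_degree (verts G) (cover_ideal G :: ('v, 'k::field) mpoly set)
    = Max (card ` {C. minimal_vertex_cover G C})"
proof -
  let ?B = "squarefree_mon ` {C. minimal_vertex_cover G C}"
  have C: "C \<subseteq> verts G" "finite C" if "minimal_vertex_cover G C" for C
  proof -
    show "C \<subseteq> verts G" using that by (simp add: minimal_vertex_cover_def vertex_cover_def)
    thus "finite C" using G by (auto simp: finite_simple_graph_def intro: finite_subset)
  qed
  have keys: "Poly_Mapping.keys (squarefree_mon C) = C" if "minimal_vertex_cover G C" for C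
    using C(2)[OF that] by (auto simp: in_keys_iff lookup_squarefree_mon split: if_splits)
  have "minimal_monomial_generators (verts G) (cover_ideal G :: ('v, 'k) mpoly set) B' \<longleftrightarrow> B' = ?B" for B'
    unfolding cover_ideal_eq[OF G]
  proof (rule minimal_monomial_generators_iff)
    fix b assume "b \<in> ?B"
    thus "Poly_Mapping.keys b \<subseteq> verts G" using keys C(1) by auto
  next
    fix b b' c assume "b \<in> ?B" "b' \<in> ?B" and eq: "b = b' + c"
    then obtain X Y where X: "minimal_vertex_cover G X" "b = squarefree_mon X"
      and Y: "minimal_vertex_cover G Y" "b' = squarefree_mon Y" by blast
    have "Y \<subseteq> X" using keys[OF X(1)] keys[OF Y(1)] X(2) Y(2) eq by (metis mon_keys_add Un_upper1)
    hence "Y = X" using X(1) Y(1) by (auto simp: minimal_vertex_cover_def)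
    thus "b' = b" using X Y by simp
  qed
  hence "{mon_degree m | m B. minimal_monomial_generators (verts G) (cover_ideal G :: ('v, 'k) mpoly set) B \<and> m \<in> B}
      = mon_degree ` ?B" by auto
  also have "\<dots> = card ` {C. minimal_vertex_cover G C}"
    unfolding image_image using C(2) by (intro image_cong) (auto simp: mon_degree_squarefree_mon)
  finally show ?thesis by (simp only: ideal_degree_def)
qed

text \<open>The set \<open>verts H\<close> is a cover, and a minimal one because of the edges
  \<open>{y, v}\<close>. The full vertex set properly contains it, so every minimal cover misses a
  vertex and is no larger.\<close>

lemma max_minimal_vertex_cover_cone:
  assumes H: "finite_simple_graph H" and y: "y \<notin> verts H"
  shows "Max (card ` {C. minimal_vertex_cover (cone_graph y H) C}) = card (verts H)"
proof (rule Max_eqI)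
  let ?G = "cone_graph y H"
  have fin: "finite (verts H)" using H by (simp add: finite_simple_graph_def)
  have e: "e \<inter> verts H \<noteq> {}" if "e \<in> edges ?G" for e
  proof (cases "e \<in> edges H")
    case True
    hence "e \<in> nsets (verts H) 2" using H by (auto simp: finite_simple_graph_def)
    hence "e \<subseteq> verts H" "e \<noteq> {}" by (auto simp: nsets_def)
    thus ?thesis by (simp add: Int_absorb2)
  next
    case False
    thus ?thesis using that by (auto simp: cone_graph_def)
  qed
  have cover: "vertex_cover ?G (verts H)"
    using e by (auto simp: vertex_cover_def cone_graph_def)
  have "\<not> vertex_cover ?G C" if sub: "C \<subset> verts H" for C
  proof
    assume C: "vertex_cover ?G C"
    obtain v where v: "v \<in> verts H" "v \<notin> C" using sub by blast
    hence "{y, v} \<in> edges ?G" by (auto simp: cone_graph_def)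
    hence "C \<inter> {y, v} \<noteq> {}" using C unfolding vertex_cover_def by blast
    thus False using v y sub by blast
  qed
  hence "minimal_vertex_cover ?G (verts H)"
    using cover by (simp add: minimal_vertex_cover_def)
  thus "card (verts H) \<in> card ` {C. minimal_vertex_cover ?G C}" by blast
  have sub: "C \<subset> insert y (verts H)" if C: "minimal_vertex_cover ?G C" for C
  proof -
    have "C \<subseteq> insert y (verts H)"
      using C by (auto simp: minimal_vertex_cover_def vertex_cover_def cone_graph_def)
    moreover have "C \<noteq> insert y (verts H)"
    proof
      assume "C = insert y (verts H)"
      hence "verts H \<subset> C" using y by blast
      thus False using C cover by (simp add: minimal_vertex_cover_def)
    qed
    ultimately show ?thesis by blast
  qed
  have "{C. minimal_vertex_cover ?G C} \<subseteq> Pow (insert y (verts H))" using sub by blast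
  hence "finite {C. minimal_vertex_cover ?G C}" by (rule finite_subset) (simp add: fin)
  thus "finite (card ` {C. minimal_vertex_cover ?G C})" by (rule finite_imageI)
  fix n assume "n \<in> card ` {C. minimal_vertex_cover ?G C}"
  then obtain C where C: "minimal_vertex_cover ?G C" "n = card C" by blast
  have "card C < card (insert y (verts H))" using sub[OF C(1)] fin by (intro psubset_card_mono) auto
  thus "n \<le> card (verts H)" using C(2) fin y by simp
qed

lemma cone_complete_graph:
  assumes "y \<in> V"
  shows "cone_graph y (complete_graph (V - {y})) = complete_graph V"
proof -
  have "nsets (V - {y}) 2 \<union> {{y, v} | v. v \<in> V - {y}} = nsets V 2"
    using assms by (auto simp: nsets_2_eq)
  thus ?thesis using assms by (simp add: cone_graph_def complete_graph_def insert_absorb)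
qed

theorem corollary3p8:
  shows
    "(\<forall>(H :: 'v ugraph) y k.
        finite_simple_graph H \<and> independence_number H \<le> 2 \<and> y \<notin> verts H \<and> k \<ge> 1 \<longrightarrow>
        (let G = cone_graph y H;
             d = int (ideal_degree (verts G) (cover_ideal G :: ('v, 'k::field) mpoly set));
             r = regularity (verts G) (symbolic_power G k :: ('v, 'k) mpoly set)
         in int k * d = r \<and> r = (int k - 1) * d + int (card (verts G)) - 1)) \<and>
     (\<forall>(V :: 'v set) n k.
        finite V \<and> card V = n \<and> n \<ge> 2 \<and> k \<ge> 1 \<longrightarrow>
        regularity V (symbolic_power (complete_graph V) k :: ('v, 'k) mpoly set)
          = int k * (int n - 1))"
proof (intro conjI allI impI; elim conjE)
  fix H :: "'v ugraph" and y and k :: nat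
  assume H: "finite_simple_graph H" and y: "y \<notin> verts H"
  let ?G = "cone_graph y H"
  have "ideal_degree (verts ?G) (cover_ideal ?G :: ('v, 'k) mpoly set) = card (verts H)"
    by (simp only: ideal_degree_cover_ideal[OF finite_simple_graph_cone[OF H y]] max_minimal_vertex_cover_cone[OF H y])
  moreover have "regularity (verts ?G) (symbolic_power ?G k :: ('v, 'k) mpoly set) = int k * int (card (verts H))"
    by (simp add: regularity_symbolic_power_cone[OF H y])
  \<comment> \<open>With \<open>d = card (verts H)\<close> this gives
    \<open>card (verts G) - 1 = d\<close>, so the right-hand expression collapses to
    \<open>k * d\<close>.\<close>
  moreover have "card (verts ?G) = Suc (card (verts H))"
    using H y by (simp add: cone_graph_def finite_simple_graph_def)
  ultimately show "let G = ?G;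
             d = int (ideal_degree (verts G) (cover_ideal G :: ('v, 'k) mpoly set));
             r = regularity (verts G) (symbolic_power G k :: ('v, 'k) mpoly set)
         in int k * d = r \<and> r = (int k - 1) * d + int (card (verts G)) - 1"
    by (simp add: Let_def algebra_simps)
next
  fix V :: "'v set" and n k :: nat
  assume V: "finite V" "card V = n" "n \<ge> 2"
  then obtain y where y: "y \<in> V" by fastforce
  \<comment> \<open>The complete graph is the cone, with any of its vertices as apex, over the
    complete graph on the others.\<close>
  let ?H = "complete_graph (V - {y})"
  have H: "finite_simple_graph ?H" using V by (auto simp: finite_simple_graph_def complete_graph_def)
  have "y \<notin> verts ?H" by (simp add: complete_graph_def)
  from regularity_symbolic_power_cone[OF H this, of k, where 'k = 'k]
  show "regularity V (symbolic_power (complete_graph V) k :: ('v, 'k) mpoly set) = int k * (int n - 1)"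
    unfolding cone_complete_graph[OF y] using V y by (simp add: complete_graph_def of_nat_diff)
qed

end
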